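(* Assume that Fröberg's conjecture (as formulated in the context) is true. Then for every fixed integer $n\ge 3$ there are only finitely many pairs $(d,e)$ such that the Taylor variety $\mathcal{T}^n_{d,e,d+1}$ is defective.
   Context: Work over $\mathbb{C}$ with variables $x=(x_1,\dots,x_n)$. Let $\mathbb{P}^{\binom{n+m}{n}-1}$ be the projective space of nonzero polynomials in $x$ of degree $\le m$ up to scaling. For integers $d,e,m\ge 0$, the Taylor variety $\mathcal{T}^n_{d,e,m}\subseteq\mathbb{P}^{\binom{n+m}{n}-1}$ is the Zariski closure of the set of all order-$m$ Taylor polynomials at the origin (Taylor series truncated after total degree $m$) of rational functions $P/Q$ with $P,Q\in\mathbb{C}[x]$, $\deg P\le d$, $\deg Q\le e$, $P(0)=Q(0)=1$. One always has $$\dim\mathcal{T}^n_{d,e,m}\le\min\left\{\binom{d+n}{n}+\binom{e+n}{n}-2,\ \binom{m+n}{n}-1\right\},$$ and $\mathcal{T}^n_{d,e,m}$ is called defective if this inequality is strict. For a power series $\sum_{i\ge 0}a_it^i$, define $\left[\sum_i a_it^i\right]_{>0}=\sum_i b_it^i$ with $b_i=a_i$ if $a_j>0$ for all $j\le i$, and $b_i=0$ otherwise. Fröberg's conjecture, in the case relevant here, states: for all integers $n\ge 1$ and $1\le e\le d$, if $I\subset\mathbb{C}[x_1,\dots,x_n]$ is the ideal generated by $e$ general forms of degrees $d,d-1,\dots,d-e+1$ (general meaning in a nonempty Zariski open subset of the space of such tuples of forms), then $\dim_{\mathbb{C}}\bigl(\mathbb{C}[x]_{d+1}/I_{d+1}\bigr)$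 equals the coefficient of $t^{d+1}$ in $$\left[\frac{\prod_{i=1}^e(1-t^{d+1-i})}{(1-t)^n}\right]_{>0}.$$ *)

theory Defs
  imports
    "HOL-Analysis.Abstract_Topology"
    "HOL-Library.Poly_Mapping"
    "HOL-Library.Extended_Nat"
    "HOL-Computational_Algebra.Formal_Power_Series"
begin

section \<open>Polynomials\<close>

text \<open>
  A polynomial over the complex numbers in variables indexed by a type \<open>'v\<close> is a finitely
  supported map from exponent vectors to coefficients; addition and multiplication are those of
  \<^theory>\<open>HOL-Library.Poly_Mapping\<close>.  The variables \<open>x\<^sub>1, \<dots>, x\<^sub>n\<close> are indexed by
  \<open>0, \<dots>, n - 1\<close>.
\<close>

abbreviation "keys \<equiv> Poly_Mapping.keys"
abbreviation "lookup \<equiv> Poly_Mapping.lookup"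

type_synonym 'v mpoly = "('v \<Rightarrow>\<^sub>0 nat) \<Rightarrow>\<^sub>0 complex"

definition mdeg :: "('v \<Rightarrow>\<^sub>0 nat) \<Rightarrow> nat" where
  "mdeg \<alpha> = (\<Sum>i\<in>keys \<alpha>. lookup \<alpha> i)"

definition mon_eval :: "('v \<Rightarrow>\<^sub>0 nat) \<Rightarrow> ('v \<Rightarrow> complex) \<Rightarrow> complex" where
  "mon_eval \<alpha> a = (\<Prod>i\<in>keys \<alpha>. a i ^ lookup \<alpha> i)"

definition meval :: "'v mpoly \<Rightarrow> ('v \<Rightarrow> complex) \<Rightarrow> complex" where
  "meval F a = (\<Sum>\<alpha>\<in>keys F. lookup F \<alpha> * mon_eval \<alpha> a)"

definition mpolys :: "'v set \<Rightarrow> 'v mpoly set" where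
  "mpolys V = {F. \<forall>\<alpha>\<in>keys F. keys \<alpha> \<subseteq> V}"

definition homogeneous :: "nat \<Rightarrow> 'v mpoly \<Rightarrow> bool" where
  "homogeneous k F \<longleftrightarrow> (\<forall>\<alpha>\<in>keys F. mdeg \<alpha> = k)"

definition exps :: "nat \<Rightarrow> nat \<Rightarrow> (nat \<Rightarrow>\<^sub>0 nat) set" where
  "exps n m = {\<alpha>. keys \<alpha> \<subseteq> {..<n} \<and> mdeg \<alpha> \<le> m}"

definition polys_le :: "nat \<Rightarrow> nat \<Rightarrow> nat mpoly set" where
  "polys_le n m = {P. keys P \<subseteq> exps n m}"

definition forms :: "nat \<Rightarrow> nat \<Rightarrow> nat mpoly set" where
  "forms n k = {P \<in> mpolys {..<n}. homogeneous k P}"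

definition cscale :: "complex \<Rightarrow> ('v \<Rightarrow>\<^sub>0 complex) \<Rightarrow> ('v \<Rightarrow>\<^sub>0 complex)" where
  "cscale c v = Poly_Mapping.map ((*) c) v"

lemma lookup_cscale [simp]: "lookup (cscale c v) i = c * lookup v i"
  unfolding cscale_def by (simp add: Poly_Mapping.map.rep_eq when_def)

lemma mon_eval_superset:
  assumes "finite K" "keys \<alpha> \<subseteq> K"
  shows "mon_eval \<alpha> a = (\<Prod>i\<in>K. a i ^ lookup \<alpha> i)"
  unfolding mon_eval_def
  by (rule prod.mono_neutral_left) (use assms in \<open>auto simp: in_keys_iff\<close>)

lemma mon_eval_add: "mon_eval (\<alpha> + \<beta>) a = mon_eval \<alpha> a * mon_eval \<beta> a"
proof -
  let ?K = "keys \<alpha> \<union> keys \<beta>"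
  have K: "finite ?K" "keys (\<alpha> + \<beta>) \<subseteq> ?K"
    by (simp_all add: keys_add)
  show ?thesis
    using mon_eval_superset[OF K] mon_eval_superset[OF K(1), of \<alpha>] mon_eval_superset[OF K(1), of \<beta>]
    by (simp add: lookup_add power_add prod.distrib)
qed

lemma mdeg_superset:
  assumes "finite K" "keys \<alpha> \<subseteq> K"
  shows "mdeg \<alpha> = (\<Sum>i\<in>K. lookup \<alpha> i)"
  unfolding mdeg_def
  by (rule sum.mono_neutral_left) (use assms in \<open>auto simp: in_keys_iff\<close>)

lemma mdeg_add: "mdeg (\<alpha> + \<beta>) = mdeg \<alpha> + mdeg \<beta>"
proof -
  let ?K = "keys \<alpha> \<union> keys \<beta>"
  have K: "finite ?K" "keys (\<alpha> + \<beta>) \<subseteq> ?K"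
    by (simp_all add: keys_add)
  show ?thesis
    using mdeg_superset[OF K] mdeg_superset[OF K(1), of \<alpha>] mdeg_superset[OF K(1), of \<beta>]
    by (simp add: lookup_add sum.distrib)
qed

lemma mdeg_eq_0_iff: "mdeg \<alpha> = 0 \<longleftrightarrow> \<alpha> = 0"
  unfolding mdeg_def by (auto simp: in_keys_iff intro: poly_mapping_eqI)

lemma meval_superset:
  assumes "finite K" "keys F \<subseteq> K"
  shows "meval F a = (\<Sum>\<alpha>\<in>K. lookup F \<alpha> * mon_eval \<alpha> a)"
  unfolding meval_def
  by (rule sum.mono_neutral_left) (use assms in \<open>auto simp: in_keys_iff\<close>)

lemma meval_add: "meval (F + G) a = meval F a + meval G a"
proof -
  let ?K = "keys F \<union> keys G"
  have K: "finite ?K" "keys (F + G) \<subseteq> ?K"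
    by (simp_all add: keys_add)
  show ?thesis
    using meval_superset[OF K] meval_superset[OF K(1), of F] meval_superset[OF K(1), of G]
    by (simp add: lookup_add ring_distribs sum.distrib)
qed

lemma meval_0 [simp]: "meval 0 a = 0"
  by (simp add: meval_def)

lemma meval_1 [simp]: "meval 1 a = 1"
  by (simp add: meval_def mon_eval_def)

lemma meval_sum: "meval (\<Sum>x\<in>X. F x) a = (\<Sum>x\<in>X. meval (F x) a)"
  by (induction X rule: infinite_finite_induct) (auto simp: meval_add)

lemma meval_single: "meval (Poly_Mapping.single \<alpha> c) a = c * mon_eval \<alpha> a"
  by (simp add: meval_def)

lemma mpoly_expand:
  fixes F :: "'k \<Rightarrow>\<^sub>0 'b::comm_monoid_add"
  shows "F = (\<Sum>\<alpha>\<in>keys F. Poly_Mapping.single \<alpha> (lookup F \<alpha>))"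
  by (rule poly_mapping_eqI) (auto simp: lookup_sum lookup_single when_def in_keys_iff)

lemma meval_mult: "meval (F * G) a = meval F a * meval G a"
proof -
  have "F * G = (\<Sum>\<alpha>\<in>keys F. \<Sum>\<beta>\<in>keys G.
      Poly_Mapping.single (\<alpha> + \<beta>) (lookup F \<alpha> * lookup G \<beta>))"
    using arg_cong2[OF mpoly_expand[of F] mpoly_expand[of G], of "(*)"]
    by (simp only: sum_product mult_single)
  then show ?thesis
    by (simp add: meval_sum meval_single mon_eval_add meval_def[of F] meval_def[of G]
        sum_product mult_ac)
qed

lemma mpolys_mult: "F \<in> mpolys V \<Longrightarrow> G \<in> mpolys V \<Longrightarrow> F * G \<in> mpolys V"
proof -
  assume FG: "F \<in> mpolys V" "G \<in> mpolys V"
  have "keys \<alpha> \<subseteq> V" if \<alpha>: "\<alpha> \<in> keys (F * G)" for \<alpha>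
  proof -
    obtain \<beta> \<gamma> where "\<alpha> = \<beta> + \<gamma>" "\<beta> \<in> keys F" "\<gamma> \<in> keys G"
      using keys_mult[of F G] \<alpha> by blast
    then show ?thesis using FG keys_add[of \<beta> \<gamma>] unfolding mpolys_def by blast
  qed
  then show ?thesis unfolding mpolys_def by blast
qed

lemma homogeneous_mult: "homogeneous k F \<Longrightarrow> homogeneous l G \<Longrightarrow> homogeneous (k + l) (F * G)"
  unfolding homogeneous_def using keys_mult[of F G] by (fastforce simp: mdeg_add)

lemma meval_cscale:
  assumes "homogeneous k F"
  shows "meval F (lookup (cscale c v)) = c ^ k * meval F (lookup v)"
proof -
  have "mon_eval \<alpha> (lookup (cscale c v)) = c ^ mdeg \<alpha> * mon_eval \<alpha> (lookup v)" for \<alpha>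
    by (simp add: mon_eval_def mdeg_def power_mult_distrib prod.distrib power_sum)
  then show ?thesis
    using assms by (simp add: meval_def homogeneous_def sum_distrib_left mult_ac)
qed


section \<open>Zariski topologies\<close>

definition zero_locus :: "'p set \<Rightarrow> ('f \<Rightarrow> 'p \<Rightarrow> bool) \<Rightarrow> 'f set \<Rightarrow> 'p set" where
  "zero_locus S van E = {x\<in>S. \<forall>F\<in>E. van F x}"

definition zariski :: "'p set \<Rightarrow> 'f set \<Rightarrow> ('f \<Rightarrow> 'p \<Rightarrow> bool) \<Rightarrow> 'p topology" where
  "zariski S \<F> van = topology (\<lambda>U. \<exists>E\<subseteq>\<F>. U = S - zero_locus S van E)"

lemma istopology_zariski:
  fixes van :: "'f::times \<Rightarrow> 'p \<Rightarrow> bool"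
  assumes mult: "\<And>F G. F \<in> \<F> \<Longrightarrow> G \<in> \<F> \<Longrightarrow> F * G \<in> \<F>"
    and van: "\<And>F G x. F \<in> \<F> \<Longrightarrow> G \<in> \<F> \<Longrightarrow> x \<in> S \<Longrightarrow> van (F * G) x \<longleftrightarrow> van F x \<or> van G x"
  shows "istopology (\<lambda>U. \<exists>E\<subseteq>\<F>. U = S - zero_locus S van E)"
  unfolding istopology_def
proof (intro conjI allI impI)
  fix U W
  assume "\<exists>E\<subseteq>\<F>. U = S - zero_locus S van E" "\<exists>E\<subseteq>\<F>. W = S - zero_locus S van E"
  then obtain E E' where E: "E \<subseteq> \<F>" "U = S - zero_locus S van E"
    "E' \<subseteq> \<F>" "W = S - zero_locus S van E'" by blast
  let ?D = "{F * G | F G. F \<in> E \<and> G \<in> E'}"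
  have "?D \<subseteq> \<F>" using E mult by blast
  moreover have "U \<inter> W = S - zero_locus S van ?D"
    unfolding E zero_locus_def using E(1,3) van by (auto 0 4)
  ultimately show "\<exists>E\<subseteq>\<F>. U \<inter> W = S - zero_locus S van E" by blast
next
  fix \<K>
  assume "\<forall>K\<in>\<K>. \<exists>E\<subseteq>\<F>. K = S - zero_locus S van E"
  then obtain e where e: "\<And>K. K \<in> \<K> \<Longrightarrow> e K \<subseteq> \<F> \<and> K = S - zero_locus S van (e K)" by metis
  have "\<Union>\<K> = S - zero_locus S van (\<Union>(e ` \<K>))"
  proof
    show "\<Union>\<K> \<subseteq> S - zero_locus S van (\<Union>(e ` \<K>))"
    proof
      fix x assume "x \<in> \<Union>\<K>"
      then obtain K where K: "K \<in> \<K>" "x \<in> K" by blast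
      then have "x \<in> S - zero_locus S van (e K)" using e by blast
      then show "x \<in> S - zero_locus S van (\<Union>(e ` \<K>))" using K by (auto simp: zero_locus_def)
    qed
    show "S - zero_locus S van (\<Union>(e ` \<K>)) \<subseteq> \<Union>\<K>"
    proof
      fix x assume "x \<in> S - zero_locus S van (\<Union>(e ` \<K>))"
      then obtain K where K: "K \<in> \<K>" "x \<in> S - zero_locus S van (e K)"
        by (auto simp: zero_locus_def)
      then have "x \<in> K" using e by blast
      then show "x \<in> \<Union>\<K>" using K by blast
    qed
  qed
  moreover have "\<Union>(e ` \<K>) \<subseteq> \<F>" using e by blast
  ultimately show "\<exists>E\<subseteq>\<F>. \<Union>\<K> = S - zero_locus S van E" by blast
qed

subsection \<open>Projective space\<close>

text \<open>
  The projective space of the coordinate space with coordinates indexed by a set \<open>V\<close>: its points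
  are the classes of nonzero vectors up to nonzero scalars.  With \<open>V = exps n m\<close> the vectors
  are the polynomials of degree at most \<open>m\<close> in \<open>n\<close> variables.
\<close>

definition proj_point :: "('v \<Rightarrow>\<^sub>0 complex) \<Rightarrow> ('v \<Rightarrow>\<^sub>0 complex) set" where
  "proj_point v = {cscale c v | c. c \<noteq> 0}"

definition proj_space :: "'v set \<Rightarrow> ('v \<Rightarrow>\<^sub>0 complex) set set" where
  "proj_space V = {proj_point v | v. v \<noteq> 0 \<and> keys v \<subseteq> V}"

definition proj_van :: "'v mpoly \<Rightarrow> ('v \<Rightarrow>\<^sub>0 complex) set \<Rightarrow> bool" where
  "proj_van F L \<longleftrightarrow> (\<forall>v\<in>L. meval F (lookup v) = 0)"

definition hom_mpolys :: "'v set \<Rightarrow> 'v mpoly set" where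
  "hom_mpolys V = {F \<in> mpolys V. \<exists>k. homogeneous k F}"

definition zariski_proj :: "'v set \<Rightarrow> ('v \<Rightarrow>\<^sub>0 complex) set topology" where
  "zariski_proj V = zariski (proj_space V) (hom_mpolys V) proj_van"

lemma proj_van_proj_point:
  assumes "homogeneous k F"
  shows "proj_van F (proj_point v) \<longleftrightarrow> meval F (lookup v) = 0"
proof -
  have "v \<in> proj_point v"
    unfolding proj_point_def by (auto intro!: exI[of _ 1] poly_mapping_eqI)
  then show ?thesis
    unfolding proj_van_def by (auto simp: proj_point_def meval_cscale[OF assms])
qed

lemma openin_zariski_proj:
  "openin (zariski_proj V) U \<longleftrightarrow>
    (\<exists>E\<subseteq>hom_mpolys V. U = proj_space V - zero_locus (proj_space V) proj_van E)"
proof -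
  have "istopology (\<lambda>U. \<exists>E\<subseteq>hom_mpolys V. U = proj_space V - zero_locus (proj_space V) proj_van E)"
  proof (rule istopology_zariski)
    fix F G :: "'a mpoly" assume FG: "F \<in> hom_mpolys V" "G \<in> hom_mpolys V"
    then obtain k l where h: "homogeneous k F" "homogeneous l G" by (auto simp: hom_mpolys_def)
    note hm = homogeneous_mult[OF h]
    show "F * G \<in> hom_mpolys V" using FG hm by (auto simp: hom_mpolys_def mpolys_mult)
    fix x assume "x \<in> proj_space V"
    then show "proj_van (F * G) x \<longleftrightarrow> proj_van F x \<or> proj_van G x"
      by (auto simp: proj_space_def proj_van_proj_point[OF hm] proj_van_proj_point[OF h(1)]
          proj_van_proj_point[OF h(2)] meval_mult)
  qed
  then show ?thesis unfolding zariski_proj_def zariski_def by simp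
qed

lemma one_hom_mpolys: "1 \<in> hom_mpolys V"
  by (auto simp: hom_mpolys_def mpolys_def homogeneous_def)

lemma topspace_zariski_proj [simp]: "topspace (zariski_proj V) = proj_space V"
proof
  show "topspace (zariski_proj V) \<subseteq> proj_space V"
    unfolding topspace_def by (auto simp: openin_zariski_proj)
  have "\<not> proj_van 1 L" if L: "L \<in> proj_space V" for L
  proof -
    obtain v where v: "L = proj_point v" using L by (auto simp: proj_space_def)
    have "homogeneous 0 (1 :: 'a mpoly)" by (simp add: homogeneous_def mdeg_def)
    from proj_van_proj_point[OF this] show ?thesis by (simp add: v)
  qed
  then have "openin (zariski_proj V) (proj_space V)"
    unfolding openin_zariski_proj
    by (intro exI[of _ "{1}"]) (auto simp: zero_locus_def one_hom_mpolys)
  then show "proj_space V \<subseteq> topspace (zariski_proj V)" by (rule openin_subset)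
qed

lemma closedin_zariski_proj:
  "closedin (zariski_proj V) Z \<longleftrightarrow>
    (\<exists>E\<subseteq>hom_mpolys V. Z = zero_locus (proj_space V) proj_van E)"
proof -
  have sub: "zero_locus (proj_space V) proj_van E \<subseteq> proj_space V" for E :: "'a mpoly set"
    by (auto simp: zero_locus_def)
  show ?thesis
  proof
    assume "closedin (zariski_proj V) Z"
    then obtain E where E: "E \<subseteq> hom_mpolys V" and Z: "Z \<subseteq> proj_space V"
      and eq: "proj_space V - Z = proj_space V - zero_locus (proj_space V) proj_van E"
      unfolding closedin_def topspace_zariski_proj openin_zariski_proj by blast
    have "Z = zero_locus (proj_space V) proj_van E" using Z eq sub[of E] by blast
    then show "\<exists>E\<subseteq>hom_mpolys V. Z = zero_locus (proj_space V) proj_van E" using E by blast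
  next
    assume "\<exists>E\<subseteq>hom_mpolys V. Z = zero_locus (proj_space V) proj_van E"
    then show "closedin (zariski_proj V) Z"
      unfolding closedin_def topspace_zariski_proj openin_zariski_proj using sub by blast
  qed
qed

subsection \<open>Tuples of forms\<close>

definition form_tuples :: "nat \<Rightarrow> nat set \<Rightarrow> (nat \<Rightarrow> nat) \<Rightarrow> (nat \<Rightarrow> nat mpoly) set" where
  "form_tuples n I D = (\<Pi>\<^sub>E i\<in>I. forms n (D i))"

text \<open>
  The coordinates of a tuple \<open>g\<close> are indexed by the pairs \<open>(i, \<alpha>)\<close>, the coordinate being the
  coefficient of \<open>x\<^sup>\<alpha>\<close> in \<open>g i\<close>.
\<close>

definition form_coords :: "nat \<Rightarrow> nat set \<Rightarrow> (nat \<Rightarrow> nat) \<Rightarrow> (nat \<times> (nat \<Rightarrow>\<^sub>0 nat)) set" where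
  "form_coords n I D = {(i, \<alpha>). i \<in> I \<and> keys \<alpha> \<subseteq> {..<n} \<and> mdeg \<alpha> = D i}"

definition tuple_van :: "(nat \<times> (nat \<Rightarrow>\<^sub>0 nat)) mpoly \<Rightarrow> (nat \<Rightarrow> nat mpoly) \<Rightarrow> bool" where
  "tuple_van F g \<longleftrightarrow> meval F (\<lambda>(i, \<alpha>). lookup (g i) \<alpha>) = 0"

definition zariski_forms :: "nat \<Rightarrow> nat set \<Rightarrow> (nat \<Rightarrow> nat) \<Rightarrow> (nat \<Rightarrow> nat mpoly) topology" where
  "zariski_forms n I D = zariski (form_tuples n I D) (mpolys (form_coords n I D)) tuple_van"

lemma openin_zariski_forms:
  "openin (zariski_forms n I D) U \<longleftrightarrow>
    (\<exists>E\<subseteq>mpolys (form_coords n I D).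
      U = form_tuples n I D - zero_locus (form_tuples n I D) tuple_van E)"
proof -
  have "istopology (\<lambda>U. \<exists>E\<subseteq>mpolys (form_coords n I D).
      U = form_tuples n I D - zero_locus (form_tuples n I D) tuple_van E)"
    by (rule istopology_zariski) (auto simp: mpolys_mult tuple_van_def meval_mult)
  then show ?thesis unfolding zariski_forms_def zariski_def by simp
qed

subsection \<open>Dimension\<close>

definition irreducible_closed :: "'p topology \<Rightarrow> 'p set \<Rightarrow> bool" where
  "irreducible_closed X Z \<longleftrightarrow> closedin X Z \<and> Z \<noteq> {} \<and>
    (\<forall>A B. closedin X A \<longrightarrow> closedin X B \<longrightarrow> Z \<subseteq> A \<union> B \<longrightarrow> Z \<subseteq> A \<or> Z \<subseteq> B)"

text \<open>Here the empty space gets dimension \<open>0\<close>; only nonempty spaces matter below.\<close>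

definition krull_dim :: "'p topology \<Rightarrow> enat" where
  "krull_dim X = Sup {enat k | k. \<exists>Z :: nat \<Rightarrow> 'p set.
    (\<forall>i\<le>k. irreducible_closed X (Z i)) \<and> (\<forall>i<k. Z i \<subset> Z (Suc i))}"


section \<open>Taylor varieties\<close>

text \<open>
  A formal power series is an arbitrary map from exponent vectors to coefficients, and
  \<open>prod_fun\<close> is the Cauchy product.  The Taylor series of \<open>P / Q\<close> at the origin is the power
  series \<open>S\<close> with \<open>Q \<cdot> S = P\<close>; it exists and is unique if \<open>Q(0) = 1\<close>.
\<close>

definition taylor_series :: "nat mpoly \<Rightarrow> nat mpoly \<Rightarrow> (nat \<Rightarrow>\<^sub>0 nat) \<Rightarrow> complex" where
  "taylor_series P Q = (THE S. prod_fun (lookup Q) S = lookup P)"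

lemma prod_fun_superset:
  fixes F :: "'k::monoid_add \<Rightarrow>\<^sub>0 complex"
  assumes "finite K" "keys F \<subseteq> K"
  shows "prod_fun (lookup F) S \<gamma> = (\<Sum>l\<in>K. lookup F l * (\<Sum>q. (S q when \<gamma> = l + q)))"
  unfolding prod_fun_def
  by (rule Sum_any.expand_superset) (use assms in \<open>auto simp: in_keys_iff\<close>)

lemma prod_fun_diff:
  fixes F G :: "'k::monoid_add \<Rightarrow>\<^sub>0 complex"
  shows "prod_fun (lookup (F - G)) S \<gamma> = prod_fun (lookup F) S \<gamma> - prod_fun (lookup G) S \<gamma>"
proof -
  let ?K = "keys F \<union> keys G"
  have K: "finite ?K" "keys (F - G) \<subseteq> ?K" "keys F \<subseteq> ?K" "keys G \<subseteq> ?K"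
    by (auto simp: in_keys_iff lookup_minus)
  show ?thesis
    by (simp add: prod_fun_superset[OF K(1,2)] prod_fun_superset[OF K(1,3)]
        prod_fun_superset[OF K(1,4)] lookup_minus ring_distribs sum_subtractf)
qed

lemma prod_fun_one: "prod_fun (lookup (1 :: 'v mpoly)) S \<gamma> = S \<gamma>"
  by (subst prod_fun_superset[of "{0}"]) (auto simp: lookup_one)

lemma prod_fun_cong_mdeg:
  assumes "\<And>l q. lookup F l \<noteq> 0 \<Longrightarrow> \<gamma> = l + q \<Longrightarrow> S q = S' q"
  shows "prod_fun (lookup F) S \<gamma> = prod_fun (lookup F) S' \<gamma>"
  unfolding prod_fun_def
proof (rule Sum_any.cong)
  fix l show "lookup F l * (\<Sum>q. (S q when \<gamma> = l + q)) = lookup F l * (\<Sum>q. (S' q when \<gamma> = l + q))"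
  proof (cases "lookup F l = 0")
    case False
    then have "(S q when \<gamma> = l + q) = (S' q when \<gamma> = l + q)" for q
      using assms[of l q] by (auto simp: when_def)
    then show ?thesis by simp
  qed simp
qed

lemma prod_fun_lookup: "prod_fun (lookup F) (lookup G) = lookup (F * G)"
  by (rule ext) (simp add: lookup_mult prod_fun_def)

lemma keys_mult_mdeg_ge:
  assumes "\<forall>\<alpha>\<in>keys F. k \<le> mdeg \<alpha>" "\<forall>\<alpha>\<in>keys G. l \<le> mdeg \<alpha>"
  shows "\<forall>\<alpha>\<in>keys (F * G). k + l \<le> mdeg \<alpha>"
proof
  fix \<alpha> assume "\<alpha> \<in> keys (F * G)"
  then obtain \<beta> \<gamma> where "\<alpha> = \<beta> + \<gamma>" "\<beta> \<in> keys F" "\<gamma> \<in> keys G"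
    using keys_mult[of F G] by blast
  then show "k + l \<le> mdeg \<alpha>" using assms by (simp add: mdeg_add add_mono)
qed

lemma meval_at_0: "meval F (\<lambda>_. 0) = lookup F 0"
proof -
  have "mon_eval \<alpha> (\<lambda>_. 0) = (if \<alpha> = 0 then 1 else 0)" for \<alpha> :: "'a \<Rightarrow>\<^sub>0 nat"
  proof (cases "\<alpha> = 0")
    case False
    then obtain i where "i \<in> keys \<alpha>"
      unfolding mdeg_eq_0_iff[symmetric] mdeg_def by fastforce
    then show ?thesis
      using False by (auto simp: mon_eval_def in_keys_iff intro!: prod_zero)
  qed (simp add: mon_eval_def)
  then have "meval F (\<lambda>_. 0) = (\<Sum>\<alpha>\<in>keys F. if \<alpha> = 0 then lookup F \<alpha> else 0)"
    unfolding meval_def by (intro sum.cong) simp_all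
  also have "\<dots> = lookup F 0" by (simp add: in_keys_iff)
  finally show ?thesis .
qed

lemma ex1_taylor_series:
  assumes Q: "meval Q (\<lambda>_. 0) = 1"
  shows "\<exists>!S. prod_fun (lookup Q) S = lookup P"
proof (rule ex_ex1I)
  have Q0: "lookup (1 - Q) 0 = 0"
    using Q by (simp add: meval_at_0 lookup_minus)
  have ord1: "\<forall>\<alpha>\<in>keys (1 - Q). 1 \<le> mdeg \<alpha>"
    using Q0 mdeg_eq_0_iff by (metis in_keys_iff less_one not_le)
  have pow: "\<forall>\<alpha>\<in>keys ((1 - Q) ^ k). k \<le> mdeg \<alpha>" for k
  proof (induction k)
    case (Suc k)
    then show ?case using keys_mult_mdeg_ge[of "1 - Q" 1 "(1 - Q) ^ k" k] ord1 by simp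
  qed simp
  define T where "T N = (\<Sum>k\<le>N. (1 - Q) ^ k)" for N
  define S where "S \<gamma> = lookup (P * T (mdeg \<gamma>)) \<gamma>" for \<gamma>
  have small: "lookup (P * (1 - Q) ^ k) \<gamma> = 0" if "mdeg \<gamma> < k" for k \<gamma>
  proof -
    have "\<forall>\<alpha>\<in>keys (P * (1 - Q) ^ k). 0 + k \<le> mdeg \<alpha>"
      by (rule keys_mult_mdeg_ge) (use pow in auto)
    then show ?thesis using that by (metis add_0 in_keys_iff not_le)
  qed
  have stab: "lookup (P * T N) \<delta> = S \<delta>" if "mdeg \<delta> \<le> N" for N \<delta>
  proof -
    have "lookup (P * T N) \<delta> = (\<Sum>k\<le>N. lookup (P * (1 - Q) ^ k) \<delta>)"
      by (simp add: T_def sum_distrib_left lookup_sum)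
    also have "\<dots> = (\<Sum>k\<le>mdeg \<delta>. lookup (P * (1 - Q) ^ k) \<delta>)"
      by (rule sum.mono_neutral_right) (use that small in auto)
    also have "\<dots> = S \<delta>" by (simp add: S_def T_def sum_distrib_left lookup_sum)
    finally show ?thesis .
  qed
  have "prod_fun (lookup Q) S \<gamma> = lookup P \<gamma>" for \<gamma>
  proof -
    have "prod_fun (lookup Q) S \<gamma> = prod_fun (lookup Q) (lookup (P * T (mdeg \<gamma>))) \<gamma>"
      by (rule prod_fun_cong_mdeg) (simp add: stab mdeg_add)
    also have "\<dots> = lookup (P * ((1 - (1 - Q)) * T (mdeg \<gamma>))) \<gamma>"
      by (simp add: prod_fun_lookup mult_ac)
    also have "(1 - (1 - Q)) * T (mdeg \<gamma>) = 1 - (1 - Q) ^ Suc (mdeg \<gamma>)"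
      unfolding T_def by (rule sum_gp_basic)
    also have "lookup (P * (1 - (1 - Q) ^ Suc (mdeg \<gamma>))) \<gamma> = lookup P \<gamma>"
      using small[of \<gamma> "Suc (mdeg \<gamma>)"]
      by (simp add: right_diff_distrib lookup_minus del: power_Suc)
    finally show ?thesis .
  qed
  then show "\<exists>S. prod_fun (lookup Q) S = lookup P" by blast
next
  fix S S' assume S: "prod_fun (lookup Q) S = lookup P" "prod_fun (lookup Q) S' = lookup P"
  have Q0: "lookup (Q - 1) 0 = 0"
    using Q by (simp add: meval_at_0 lookup_minus)
  have rec: "R \<gamma> = lookup P \<gamma> - prod_fun (lookup (Q - 1)) R \<gamma>"
    if "prod_fun (lookup Q) R = lookup P" for R \<gamma>
    using that by (simp add: prod_fun_diff prod_fun_one)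
  have "S \<gamma> = S' \<gamma>" for \<gamma>
  proof (induction "mdeg \<gamma>" arbitrary: \<gamma> rule: less_induct)
    case less
    have "prod_fun (lookup (Q - 1)) S \<gamma> = prod_fun (lookup (Q - 1)) S' \<gamma>"
    proof (rule prod_fun_cong_mdeg)
      fix l q assume l: "lookup (Q - 1) l \<noteq> 0" "\<gamma> = l + q"
      then have "mdeg l \<noteq> 0" using Q0 by (auto simp: mdeg_eq_0_iff)
      then show "S q = S' q" using less l by (simp add: mdeg_add)
    qed
    then show ?case using rec[OF S(1)] rec[OF S(2)] by simp
  qed
  then show "S = S'" by blast
qed

lemma finite_exps: "finite (exps n m)"
proof -
  let ?A = "{f. \<forall>i. (i \<in> {..<n} \<longrightarrow> f i \<in> {..m}) \<and> (i \<notin> {..<n} \<longrightarrow> f i = 0)}"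
  have "lookup \<alpha> \<in> ?A" if \<alpha>: "\<alpha> \<in> exps n m" for \<alpha>
  proof -
    have le: "lookup \<alpha> i \<le> m" for i
    proof (cases "i \<in> keys \<alpha>")
      case True
      then have "lookup \<alpha> i \<le> mdeg \<alpha>"
        unfolding mdeg_def by (rule member_le_sum) auto
      then show ?thesis using \<alpha> by (simp add: exps_def)
    qed (simp add: in_keys_iff)
    have "lookup \<alpha> i = 0" if "i \<notin> {..<n}" for i
    proof -
      have "i \<notin> keys \<alpha>" using \<alpha> that unfolding exps_def by blast
      then show ?thesis by (simp add: in_keys_iff)
    qed
    then show ?thesis using le by simp
  qed
  then have "lookup ` exps n m \<subseteq> ?A" by (rule image_subsetI)
  moreover have "finite ?A"
    using finite_set_of_finite_funs[of "{..<n}" "{..m}" "0 :: nat"] by blast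
  ultimately have "finite (lookup ` exps n m)" by (rule finite_subset)
  moreover have "inj_on lookup (exps n m)" by (rule inj_onI) (simp only: poly_mapping_eq_iff)
  ultimately show ?thesis by (rule finite_imageD)
qed

definition taylor_poly :: "nat \<Rightarrow> nat \<Rightarrow> nat mpoly \<Rightarrow> nat mpoly \<Rightarrow> nat mpoly" where
  "taylor_poly n m P Q =
    (\<Sum>\<alpha>\<in>exps n m. Poly_Mapping.single \<alpha> (taylor_series P Q \<alpha>))"

definition taylor_variety :: "nat \<Rightarrow> nat \<Rightarrow> nat \<Rightarrow> nat \<Rightarrow> nat mpoly set set" where
  "taylor_variety n d e m = zariski_proj (exps n m) closure_of
    {proj_point (taylor_poly n m P Q) | P Q.
      P \<in> polys_le n d \<and> Q \<in> polys_le n e \<and> meval P (\<lambda>_. 0) = 1 \<and> meval Q (\<lambda>_. 0) = 1}"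

definition taylor_defective :: "nat \<Rightarrow> nat \<Rightarrow> nat \<Rightarrow> nat \<Rightarrow> bool" where
  "taylor_defective n d e m \<longleftrightarrow>
    krull_dim (subtopology (zariski_proj (exps n m)) (taylor_variety n d e m)) <
    enat (min (((d + n) choose n) + ((e + n) choose n) - 2) (((m + n) choose n) - 1))"


section \<open>Froeberg's conjecture\<close>

definition ideal_gen :: "nat \<Rightarrow> nat set \<Rightarrow> (nat \<Rightarrow> nat mpoly) \<Rightarrow> nat mpoly set" where
  "ideal_gen n I g = {\<Sum>i\<in>I. h i * g i | h. \<forall>i\<in>I. h i \<in> mpolys {..<n}}"

text \<open>The residue classes of the elements of \<open>B\<close> form a basis of \<open>V / W\<close>.\<close>

definition quotient_basis ::
    "('k \<Rightarrow>\<^sub>0 complex) set \<Rightarrow> ('k \<Rightarrow>\<^sub>0 complex) set \<Rightarrow> ('k \<Rightarrow>\<^sub>0 complex) set \<Rightarrow> bool" where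
  "quotient_basis V W B \<longleftrightarrow> finite B \<and> B \<subseteq> V \<and>
    (\<forall>v\<in>V. \<exists>c. v - (\<Sum>b\<in>B. cscale (c b) b) \<in> W) \<and>
    (\<forall>c. (\<Sum>b\<in>B. cscale (c b) b) \<in> W \<longrightarrow> (\<forall>b\<in>B. c b = 0))"

definition quotient_dim :: "('k \<Rightarrow>\<^sub>0 complex) set \<Rightarrow> ('k \<Rightarrow>\<^sub>0 complex) set \<Rightarrow> nat" where
  "quotient_dim V W = (THE k. \<exists>B. quotient_basis V W B \<and> card B = k)"

definition fps_pos_part :: "real fps \<Rightarrow> real fps" where
  "fps_pos_part F = Abs_fps (\<lambda>i. if \<forall>j\<le>i. fps_nth F j > 0 then fps_nth F i else 0)"

definition froeberg_conjecture :: bool where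
  "froeberg_conjecture \<longleftrightarrow> (\<forall>n d e. 1 \<le> n \<longrightarrow> 1 \<le> e \<longrightarrow> e \<le> d \<longrightarrow>
    (\<exists>U. openin (zariski_forms n {1..e} (\<lambda>i. d + 1 - i)) U \<and> U \<noteq> {} \<and>
      (\<forall>g\<in>U. real (quotient_dim (forms n (d + 1)) (ideal_gen n {1..e} g \<inter> forms n (d + 1))) =
        fps_nth (fps_pos_part ((\<Prod>i=1..e. 1 - fps_X ^ (d + 1 - i)) / (1 - fps_X) ^ n)) (d + 1))))"

end

theory Submission
  imports Defs "HOL-Computational_Algebra.Polynomial"
begin

text \<open>
  Writing a Taylor polynomial of order \<open>d + 1\<close> as \<open>T + f\<close> with \<open>T\<close> of degree at most
  \<open>d\<close> and \<open>f\<close> homogeneous of degree \<open>d + 1\<close>, the polynomial \<open>T\<close> is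
  arbitrary with \<open>T(0) = 1\<close>, and \<open>f\<close> ranges over the forms
  \<open>\<Sum>\<^sub>i Q\<^sub>i T\<^bsub>d+1-i\<^esub>\<close> with \<open>i = 1, \<dots>, e\<close> and \<open>Q\<^sub>i\<close> a form of degree
  \<open>i\<close>. For \<open>e \<le> d\<close> these are the elements of degree \<open>d + 1\<close> of the ideal generated
  by the components of degrees \<open>d, \<dots>, d - e + 1\<close> of \<open>T\<close>, so the dimension of the Taylor
  variety is at least the dimension of the space of all \<open>T\<close> plus the dimension of this space for any single
  \<open>T\<close>.

  If \<open>2 e \<le> d + 1\<close>, no Koszul syzygies interfere in degree \<open>d + 1\<close>, and Froeberg's conjecture
  yields a \<open>T\<close> for which that dimension is the expected one. If \<open>2 e > d + 1\<close> and \<open>d\<close>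
  is large, the forms belonging to \<open>e' = \<lfloor>(d + 1) / 2\<rfloor>\<close> already generate everything in degree
  \<open>d + 1\<close>, because \<open>e'\<^sup>n\<close> outgrows \<open>d\<^bsup>n-1\<^esup>\<close>. For \<open>e > d\<close> the constant term of \<open>T\<close> does so.
\<close>

section \<open>Counting monomials\<close>

definition mons :: "nat \<Rightarrow> nat \<Rightarrow> (nat \<Rightarrow>\<^sub>0 nat) set" where
  "mons n k = {\<alpha>. keys \<alpha> \<subseteq> {..<n} \<and> mdeg \<alpha> = k}"

lemma finite_mons: "finite (mons n k)"
  by (rule finite_subset[OF _ finite_exps[of n k]]) (auto simp: mons_def exps_def)

text \<open>Stars and bars: an exponent vector is the list of its first \<open>n\<close>
  entries.\<close>

lemma card_mons: "card (mons n k) = (k + n - 1) choose k"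
proof -
  let ?f = "\<lambda>\<alpha> :: nat \<Rightarrow>\<^sub>0 nat. map (lookup \<alpha>) [0..<n]"
  have deg: "mdeg \<alpha> = (\<Sum>i<n. lookup \<alpha> i)" if "keys \<alpha> \<subseteq> {..<n}" for \<alpha> :: "nat \<Rightarrow>\<^sub>0 nat"
    using mdeg_superset[OF _ that] by simp
  have "bij_betw ?f (mons n k) {l. length l = n \<and> sum_list l = k}"
  proof (rule bij_betw_imageI)
    show "inj_on ?f (mons n k)"
    proof (rule inj_onI, rule poly_mapping_eqI)
      fix \<alpha> \<beta> i assume \<alpha>\<beta>: "\<alpha> \<in> mons n k" "\<beta> \<in> mons n k" "?f \<alpha> = ?f \<beta>"
      show "lookup \<alpha> i = lookup \<beta> i"
      proof (cases "i < n")
        case True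
        then show ?thesis using \<alpha>\<beta>(3) by simp
      next
        case False
        then have "i \<notin> keys \<alpha>" "i \<notin> keys \<beta>" using \<alpha>\<beta>(1,2) by (auto simp: mons_def)
        then show ?thesis by (simp add: in_keys_iff)
      qed
    qed
    show "?f ` mons n k = {l. length l = n \<and> sum_list l = k}"
    proof (intro equalityI subsetI)
      fix l assume "l \<in> ?f ` mons n k"
      then show "l \<in> {l. length l = n \<and> sum_list l = k}"
        by (auto simp: mons_def deg sum_list_distinct_conv_sum_set atLeast0LessThan)
    next
      fix l assume l: "l \<in> {l. length l = n \<and> sum_list l = k}"
      define \<alpha> where "\<alpha> = Poly_Mapping.Abs_poly_mapping (\<lambda>i. if i < n then l ! i else 0)"
      have look: "lookup \<alpha> i = (if i < n then l ! i else 0)" for i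
        unfolding \<alpha>_def by (subst lookup_Abs_poly_mapping) (auto intro: finite_subset[of _ "{..<n}"])
      have "?f \<alpha> = l" using l by (intro nth_equalityI) (auto simp: look)
      moreover have "\<alpha> \<in> mons n k"
      proof -
        have sub: "keys \<alpha> \<subseteq> {..<n}" by (auto simp: in_keys_iff look split: if_splits)
        have "(\<Sum>i<n. lookup \<alpha> i) = k"
          using l by (auto simp: look sum_list_sum_nth atLeast0LessThan)
        then show ?thesis using sub deg[OF sub] by (simp add: mons_def)
      qed
      ultimately show "l \<in> ?f ` mons n k" by blast
    qed
  qed
  then show ?thesis by (simp add: bij_betw_same_card card_length_sum_list)
qed

lemma card_exps: "card (exps n m) = (m + n) choose n"
proof -
  have "exps n m = (\<Union>k\<le>m. mons n k)" by (auto simp: exps_def mons_def)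
  moreover have "card (\<Union>k\<le>m. mons n k) = (\<Sum>k\<le>m. card (mons n k))"
    by (rule card_UN_disjoint) (auto simp: finite_mons, auto simp: mons_def)
  ultimately have "card (exps n m) = (\<Sum>k\<le>m. (k + n - 1) choose k)"
    by (simp add: card_mons)
  also have "\<dots> = (m + n) choose n"
  \<comment> \<open>For \<open>n = 0\<close> truncated subtraction leaves only the term
    \<open>k = 0\<close>; otherwise the sum is the hockey-stick identity.\<close>
  proof (cases n)
    case 0
    have "(\<Sum>k\<le>m. (k - 1) choose k) = (\<Sum>k\<in>{0}. (k - 1) choose k)"
      by (rule sum.mono_neutral_right) auto
    then show ?thesis using 0 by simp
  next
    case (Suc r)
    have "(\<Sum>k\<le>m. (r + k) choose k) = Suc (r + m) choose m" by (rule sum_choose_lower)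
    also have "\<dots> = (m + n) choose n"
      using Suc binomial_symmetric[of m "m + n"] by (simp add: add.commute)
    finally show ?thesis using Suc by (simp add: add.commute)
  qed
  finally show ?thesis .
qed

lemma card_exps_Suc: "card (exps n (Suc d)) = card (exps n d) + card (mons n (Suc d))"
proof -
  have "exps n (Suc d) = exps n d \<union> mons n (Suc d)" "exps n d \<inter> mons n (Suc d) = {}"
    by (auto simp: exps_def mons_def)
  then show ?thesis by (simp add: card_Un_disjoint finite_exps finite_mons)
qed

text \<open>The left side is at most \<open>(3 * e) ^ (n - 1)\<close>, while the right side grows
  like \<open>(e / n) ^ n\<close>, one power more; the bound on \<open>e\<close> beats the
  constants. With \<open>e\<close> about \<open>d / 2\<close> this makes the number of all monomials
  of degree \<open>d + 1\<close> the smaller term of the expected rank.\<close>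

lemma binomial_growth:
  fixes n e d :: nat
  assumes n: "n \<ge> 1" and e: "e \<ge> n ^ n * 3 ^ n" and d: "d \<le> 2 * e"
  shows "card (mons n (Suc d)) \<le> card (exps n e) - 1"
proof -
  have "n ^ 1 \<le> n ^ n" using n by (intro power_increasing) auto
  then have "n * 1 \<le> n ^ n * 3 ^ n" by (intro mult_le_mono) auto
  with e have ne: "n \<le> e" by linarith
  have "card (mons n (Suc d)) = (d + n) choose (n - 1)"
    using binomial_symmetric[of "n - 1" "d + n"] n by (simp add: card_mons)
  also have "\<dots> \<le> (d + n) ^ (n - 1)"
    using n by (intro binomial_le_pow) auto
  also have "\<dots> \<le> (3 * e) ^ (n - 1)"
    using d ne by (intro power_mono) auto
  finally have upper: "card (mons n (Suc d)) \<le> (3 * e) ^ (n - 1)" .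
  have "(real (e + n) / real n) ^ n \<le> real ((e + n) choose n)"
    by (rule binomial_ge_n_over_k_pow_k) simp
  then have "real ((e + n) ^ n) \<le> real (((e + n) choose n) * n ^ n)"
    using n by (simp add: power_divide divide_le_eq)
  then have low: "(e + n) ^ n \<le> ((e + n) choose n) * n ^ n"
    by (simp only: of_nat_le_iff)
  \<comment> \<open>Multiplying by \<open>n ^ n\<close> avoids division. The \<open>+ 1\<close>
    stands for the constant monomial and is absorbed by one spare factor \<open>3\<close>.\<close>
  have "n ^ n * ((3 * e) ^ (n - 1) + 1) \<le> n ^ n * (3 ^ n * e ^ (n - 1))"
  proof (rule mult_le_mono2)
    have "(3::nat) ^ n * e ^ (n - 1) = 3 * (3 * e) ^ (n - 1)"
      using n by (cases n) (auto simp: power_mult_distrib)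
    moreover have "1 \<le> (3 * e) ^ (n - 1)" using ne n by simp
    ultimately show "(3 * e) ^ (n - 1) + 1 \<le> 3 ^ n * e ^ (n - 1)" by linarith
  qed
  also have "\<dots> = (n ^ n * 3 ^ n) * e ^ (n - 1)" by simp
  also have "\<dots> \<le> e * e ^ (n - 1)" using e by (rule mult_le_mono1)
  also have "\<dots> = e ^ n" using n by (cases n) auto
  also have "\<dots> \<le> (e + n) ^ n" by (intro power_mono) auto
  also have "\<dots> \<le> n ^ n * ((e + n) choose n)" using low by (simp add: mult.commute)
  finally have "n ^ n * ((3 * e) ^ (n - 1) + 1) \<le> n ^ n * ((e + n) choose n)" .
  then have "(3 * e) ^ (n - 1) + 1 \<le> (e + n) choose n"
    using n unfolding mult_le_cancel1 by simp
  then show ?thesis using upper by (simp add: card_exps)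
qed

section \<open>The Hilbert series in Froeberg's conjecture\<close>

text \<open>This is the Hilbert series of the polynomial ring in \<open>n\<close> variables.\<close>

lemma fps_inverse_one_minus_X_power:
  assumes "n \<ge> 1"
  shows "inverse ((1 - fps_X :: real fps) ^ n) = Abs_fps (\<lambda>k. real (card (mons n k)))"
  using assms one_minus_const_fps_X_neg_power'[of n "1::real"]
  by (simp add: card_mons add.commute)

text \<open>In the expanded product every term with two or more factors \<open>fps_X ^ a i\<close>
  is divisible by \<open>fps_X ^ Suc N\<close>; \<open>R\<close> collects these terms.\<close>

lemma prod_one_minus_X_power:
  fixes a :: "nat \<Rightarrow> nat"
  assumes "finite I" "\<And>i j. i \<in> I \<Longrightarrow> j \<in> I \<Longrightarrow> i \<noteq> j \<Longrightarrow> N < a i + a j"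
  shows "\<exists>R. (\<Prod>i\<in>I. 1 - fps_X ^ a i :: real fps) = 1 - (\<Sum>i\<in>I. fps_X ^ a i) + fps_X ^ Suc N * R"
  using assms
proof (induction I)
  case (insert k I)
  obtain R where R: "(\<Prod>i\<in>I. 1 - fps_X ^ a i :: real fps)
      = 1 - (\<Sum>i\<in>I. fps_X ^ a i) + fps_X ^ Suc N * R"
    using insert by blast
  have "fps_X ^ a i * fps_X ^ a k = (fps_X ^ Suc N * fps_X ^ (a i + a k - Suc N) :: real fps)"
    if "i \<in> I" for i
  proof -
    have "N < a i + a k" using insert.prems[of i k] insert.hyps that by auto
    then show ?thesis unfolding power_add[symmetric] by (simp del: power_Suc)
  qed
  then have eq: "(\<Sum>i\<in>I. fps_X ^ a i) * fps_X ^ a k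
      = (fps_X ^ Suc N * (\<Sum>i\<in>I. fps_X ^ (a i + a k - Suc N)) :: real fps)"
    unfolding sum_distrib_left sum_distrib_right by (rule sum.cong[OF refl])
  have alg: "(1 - x) * (1 - S + Y * R) = 1 - (x + S) + Y * (R - R * x + T)"
    if "S * x = Y * T" for S T x Y :: "real fps"
    using that by (simp add: algebra_simps)
  have "(\<Prod>i\<in>insert k I. 1 - fps_X ^ a i :: real fps) = 1 - (\<Sum>i\<in>insert k I. fps_X ^ a i)
      + fps_X ^ Suc N * (R - R * fps_X ^ a k + (\<Sum>i\<in>I. fps_X ^ (a i + a k - Suc N)))"
    using alg[OF eq] by (simp only: prod.insert[OF insert.hyps] sum.insert[OF insert.hyps] R)
  then show ?case by blast
qed (auto intro!: exI[of _ 0])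

text \<open>The bound \<open>2 * e \<le> d + 1\<close> makes the products of two of the forms have degree above
  \<open>d + 1\<close>, so that no Koszul syzygies contribute.\<close>

lemma froeberg_coefficient:
  assumes n: "n \<ge> 1" and e: "2 * e \<le> d + 1"
  shows "fps_nth ((\<Prod>i=1..e. 1 - fps_X ^ (d + 1 - i)) / (1 - fps_X) ^ n :: real fps) (d + 1)
    = real (card (mons n (d + 1))) - (real (card (exps n e)) - 1)"
proof -
  define H where "H = Abs_fps (\<lambda>k. real (card (mons n k)))"
  \<comment> \<open>Distinct \<open>i\<close>, \<open>j\<close> in \<open>{1..e}\<close> have
    \<open>i + j \<le> 2 * e - 1 \<le> d\<close>, so the two exponents add up to at least
    \<open>d + 2\<close>.\<close>
  obtain R where R: "(\<Prod>i=1..e. 1 - fps_X ^ (d + 1 - i) :: real fps)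
      = 1 - (\<Sum>i=1..e. fps_X ^ (d + 1 - i)) + fps_X ^ Suc (d + 1) * R"
    using prod_one_minus_X_power[of "{1..e}" "d + 1" "\<lambda>i. d + 1 - i"] e by fastforce
  have "(\<Prod>i=1..e. 1 - fps_X ^ (d + 1 - i)) / (1 - fps_X) ^ n
      = (\<Prod>i=1..e. 1 - fps_X ^ (d + 1 - i)) * H"
    unfolding H_def fps_inverse_one_minus_X_power[OF n, symmetric]
    by (rule fps_divide_unit) simp
  also have "\<dots> = H - (\<Sum>i=1..e. fps_X ^ (d + 1 - i) * H) + fps_X ^ Suc (d + 1) * (R * H)"
    unfolding R by (simp add: algebra_simps sum_distrib_left)
  also have "fps_nth \<dots> (d + 1) = fps_nth H (d + 1)
      - (\<Sum>i=1..e. fps_nth (fps_X ^ (d + 1 - i) * H) (d + 1))"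
    unfolding fps_sub_nth fps_add_nth fps_sum_nth fps_X_power_mult_nth by simp
  also have "(\<Sum>i=1..e. fps_nth (fps_X ^ (d + 1 - i) * H) (d + 1)) = (\<Sum>i=1..e. fps_nth H i)"
    by (rule sum.cong[OF refl]) (use e in \<open>auto simp: fps_X_power_mult_nth\<close>)
  also have "\<dots> = real (card (exps n e)) - 1"
  proof -
    have "exps n e = (\<Union>k\<in>{0..e}. mons n k)" by (auto simp: exps_def mons_def)
    moreover have "card (\<Union>k\<in>{0..e}. mons n k) = (\<Sum>k\<in>{0..e}. card (mons n k))"
      by (rule card_UN_disjoint) (auto simp: finite_mons, auto simp: mons_def)
    moreover have "(\<Sum>k\<in>{0..e}. card (mons n k)) = 1 + (\<Sum>k\<in>{1..e}. card (mons n k))"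
      by (subst sum.atLeast_Suc_atMost) (auto simp: card_mons)
    ultimately show ?thesis by (simp add: H_def)
  qed
  finally show ?thesis by (simp add: H_def)
qed

section \<open>Linear algebra of finitely supported families\<close>

interpretation pm: vector_space "cscale :: complex \<Rightarrow> ('k \<Rightarrow>\<^sub>0 complex) \<Rightarrow> ('k \<Rightarrow>\<^sub>0 complex)"
  by standard (auto intro!: poly_mapping_eqI simp: lookup_add algebra_simps)

text \<open>Provides linear functionals extended from independent sets, which later separate
  consecutive members of a chain.\<close>

interpretation pmc: vector_space_pair
    "cscale :: complex \<Rightarrow> ('k \<Rightarrow>\<^sub>0 complex) \<Rightarrow> ('k \<Rightarrow>\<^sub>0 complex)" "(*) :: complex \<Rightarrow> complex \<Rightarrow> complex"
  by standard (auto simp: algebra_simps)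

lemma coordinate_expansion:
  assumes "finite A" "keys v \<subseteq> A"
  shows "v = (\<Sum>\<alpha>\<in>A. cscale (lookup v \<alpha>) (Poly_Mapping.single \<alpha> 1))"
  by (rule poly_mapping_eqI) (use assms in \<open>auto simp: lookup_sum lookup_single when_def in_keys_iff
      if_distrib[of "(*) _"] cong: if_cong\<close>)

lemma independent_units:
  "pm.independent ((\<lambda>\<alpha>. Poly_Mapping.single \<alpha> (1 :: complex)) ` A)"
  unfolding pm.independent_explicit_module
proof (intro allI impI)
  fix t :: "('a \<Rightarrow>\<^sub>0 complex) set" and u v
  assume t: "finite t" "t \<subseteq> (\<lambda>\<alpha>. Poly_Mapping.single \<alpha> 1) ` A"
    "(\<Sum>v\<in>t. cscale (u v) v) = 0" "v \<in> t"
  then obtain \<beta> where \<beta>: "v = Poly_Mapping.single \<beta> 1" by blast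
  have "lookup (cscale (u w) w) \<beta> = (if w = v then u v else 0)" if w: "w \<in> t" for w
  proof -
    obtain \<gamma> where "w = Poly_Mapping.single \<gamma> 1" using w t(2) by blast
    moreover from this have "w = v \<longleftrightarrow> \<gamma> = \<beta>" unfolding \<beta> by (metis keys_single singleton_inject zero_neq_one)
    ultimately show ?thesis unfolding \<beta> by (auto simp: lookup_single when_def)
  qed
  then have "lookup (\<Sum>v\<in>t. cscale (u v) v) \<beta> = u v"
    using t(1,4) by (simp add: lookup_sum)
  then show "u v = 0" using t(3) by simp
qed

lemma card_units: "card ((\<lambda>\<alpha>. Poly_Mapping.single \<alpha> (1 :: complex)) ` A) = card A"
  by (rule card_image) (auto intro!: inj_onI simp: poly_mapping_eq_iff lookup_single fun_eq_iff when_def split: if_splits)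

text \<open>A basis of \<open>W\<close> together with representatives of a basis of
  \<open>V / W\<close> is a basis of \<open>V\<close>. Hence all quotient bases have the same size,
  on which the definite description in \<open>quotient_dim\<close> relies.\<close>

lemma quotient_basis_card:
  assumes W: "pm.subspace W" "W \<subseteq> V" and V: "V \<subseteq> pm.span T" "finite T" "pm.subspace V"
    and A: "A \<subseteq> W" "pm.independent A" "W \<subseteq> pm.span A"
    and B: "quotient_basis V W B"
  shows "card A + card B = pm.dim V"
proof -
  have finA: "finite A"
    using pm.independent_span_bound[of T A] A V W by blast
  have finB: "finite B" and BV: "B \<subseteq> V"
    and spB: "\<And>v. v \<in> V \<Longrightarrow> \<exists>c. v - (\<Sum>b\<in>B. cscale (c b) b) \<in> W"
    and indB: "\<And>c b. (\<Sum>b\<in>B. cscale (c b) b) \<in> W \<Longrightarrow> b \<in> B \<Longrightarrow> c b = 0"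
    using B unfolding quotient_basis_def by blast+
  have disj: "A \<inter> B = {}"
  proof (rule ccontr)
    assume "A \<inter> B \<noteq> {}"
    then obtain b where b: "b \<in> A" "b \<in> B" by blast
    have "(\<Sum>x\<in>B. cscale (if x = b then 1 else 0) x) = (\<Sum>x\<in>B. if x = b then cscale 1 b else 0)"
      by (rule sum.cong) auto
    also have "\<dots> = b" using b finB by simp
    finally show False using indB[of "\<lambda>x. if x = b then 1 else 0" b] b A by auto
  qed
  have ind: "pm.independent (A \<union> B)"
  proof (rule pm.independent_if_scalars_zero)
    show "finite (A \<union> B)" using finA finB by simp
    fix f x assume f: "(\<Sum>x\<in>A \<union> B. cscale (f x) x) = 0" and x: "x \<in> A \<union> B"
    have s: "(\<Sum>x\<in>A. cscale (f x) x) + (\<Sum>x\<in>B. cscale (f x) x) = 0"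
      using f disj finA finB by (simp add: sum.union_disjoint)
    then have "(\<Sum>x\<in>B. cscale (f x) x) = - (\<Sum>x\<in>A. cscale (f x) x)"
      by (simp add: eq_neg_iff_add_eq_0 add.commute)
    moreover have "(\<Sum>x\<in>A. cscale (f x) x) \<in> W"
      using A W by (intro pm.subspace_sum pm.subspace_scale) auto
    ultimately have "(\<Sum>x\<in>B. cscale (f x) x) \<in> W"
      using W by (simp add: pm.subspace_neg)
    then have zB: "f b = 0" if "b \<in> B" for b using indB that by blast
    then have "(\<Sum>x\<in>A. cscale (f x) x) = 0" using s by simp
    then have "f a = 0" if "a \<in> A" for a
      using pm.independentD[OF A(2) finA] that by blast
    then show "f x = 0" using x zB by blast
  qed
  have "V \<subseteq> pm.span (A \<union> B)"
  proof
    fix v assume "v \<in> V"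
    then obtain c where c: "v - (\<Sum>b\<in>B. cscale (c b) b) \<in> W" using spB by blast
    then have "v - (\<Sum>b\<in>B. cscale (c b) b) \<in> pm.span (A \<union> B)"
      using A(3) pm.span_mono[of A "A \<union> B"] by blast
    moreover have "(\<Sum>b\<in>B. cscale (c b) b) \<in> pm.span (A \<union> B)"
      by (intro pm.span_sum pm.span_scale pm.span_base) auto
    ultimately show "v \<in> pm.span (A \<union> B)"
      using pm.span_add by fastforce
  qed
  moreover have "A \<union> B \<subseteq> V" using A W BV by blast
  ultimately have "card (A \<union> B) = pm.dim V"
    using ind by (intro pm.basis_card_eq_dim)
  then show ?thesis using disj finA finB by (simp add: card_Un_disjoint)
qed

text \<open>Completing a basis \<open>A\<close> of \<open>W\<close> to a basis \<open>C\<close> of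
  \<open>V\<close> gives the quotient basis \<open>C - A\<close>, so \<open>quotient_dim\<close> is
  the codimension. The set \<open>A\<close> is returned because the chain of subvarieties is built
  from it.\<close>

lemma quotient_dim_complement:
  assumes W: "pm.subspace W" "W \<subseteq> V" and V: "V \<subseteq> pm.span T" "finite T" "pm.subspace V"
  obtains A where "A \<subseteq> W" "pm.independent A" "finite A" "card A + quotient_dim V W = pm.dim V"
proof -
  obtain A where A: "A \<subseteq> W" "pm.independent A" "W \<subseteq> pm.span A"
    by (rule pm.maximal_independent_subset)
  obtain C where C: "A \<subseteq> C" "C \<subseteq> V" "pm.independent C" "V \<subseteq> pm.span C"
    by (rule pm.maximal_independent_subset_extend[of A V]) (use A W in auto)
  have finC: "finite C"
    using pm.independent_span_bound[of T C] C V by blast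
  have finA: "finite A" using finC C(1) by (rule finite_subset[rotated])
  have "quotient_basis V W (C - A)"
    unfolding quotient_basis_def
  proof (intro conjI ballI allI impI)
    show "finite (C - A)" "C - A \<subseteq> V" using finC C by auto
  next
    fix v assume "v \<in> V"
    then obtain c where c: "v = (\<Sum>b\<in>C. cscale (c b) b)"
      using C(4) pm.span_finite[OF finC] by blast
    have "v = (\<Sum>b\<in>C - A. cscale (c b) b) + (\<Sum>b\<in>A. cscale (c b) b)"
      unfolding c using sum.subset_diff[OF C(1) finC] .
    then have "v - (\<Sum>b\<in>C - A. cscale (c b) b) = (\<Sum>b\<in>A. cscale (c b) b)" by simp
    also have "\<dots> \<in> W" using A W by (intro pm.subspace_sum pm.subspace_scale) auto
    finally show "\<exists>c. v - (\<Sum>b\<in>C - A. cscale (c b) b) \<in> W" by blast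
  next
    fix c b assume c: "(\<Sum>b\<in>C - A. cscale (c b) b) \<in> W" and b: "b \<in> C - A"
    then obtain a where a: "(\<Sum>b\<in>C - A. cscale (c b) b) = (\<Sum>b\<in>A. cscale (a b) b)"
      using A(3) pm.span_finite[OF finA] by blast
    \<comment> \<open>Expanding the combination of \<open>C - A\<close> in \<open>A\<close> turns
      its membership in \<open>W\<close> into a linear relation on the basis
      \<open>C\<close>.\<close>
    define f where "f x = (if x \<in> A then - a x else c x)" for x
    have "(\<Sum>x\<in>C. cscale (f x) x) = (\<Sum>x\<in>C - A. cscale (f x) x) + (\<Sum>x\<in>A. cscale (f x) x)"
      using sum.subset_diff[OF C(1) finC] .
    also have "(\<Sum>x\<in>C - A. cscale (f x) x) = (\<Sum>x\<in>C - A. cscale (c x) x)"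
      by (rule sum.cong) (auto simp: f_def)
    also have "(\<Sum>x\<in>A. cscale (f x) x) = - (\<Sum>x\<in>A. cscale (a x) x)"
      unfolding sum_negf[symmetric] by (rule sum.cong) (auto simp: f_def)
    finally have "(\<Sum>x\<in>C. cscale (f x) x) = 0" using a by simp
    then have "f b = 0" using pm.independentD[OF C(3) finC] b by blast
    then show "c b = 0" using b by (simp add: f_def)
  qed
  moreover have card: "card A + card B = pm.dim V" if "quotient_basis V W B" for B
    by (rule quotient_basis_card[OF W V A that])
  ultimately have "\<exists>!k. \<exists>B. quotient_basis V W B \<and> card B = k"
    by (metis add_left_cancel)
  then have "\<exists>B. quotient_basis V W B \<and> card B = quotient_dim V W"
    unfolding quotient_dim_def by (rule theI')
  then have "card A + quotient_dim V W = pm.dim V" using card by force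
  then show ?thesis by (rule that[OF A(1,2) finA])
qed

section \<open>Homogeneous components\<close>

definition hcomp :: "nat \<Rightarrow> 'v mpoly \<Rightarrow> 'v mpoly" where
  "hcomp k F = (\<Sum>\<alpha>\<in>{\<alpha> \<in> keys F. mdeg \<alpha> = k}. Poly_Mapping.single \<alpha> (lookup F \<alpha>))"

lemma lookup_hcomp: "lookup (hcomp k F) \<alpha> = (if mdeg \<alpha> = k then lookup F \<alpha> else 0)"
  unfolding hcomp_def by (auto simp: lookup_sum lookup_single when_def in_keys_iff)

lemma hcomp_add: "hcomp k (F + G) = hcomp k F + hcomp k G"
  by (rule poly_mapping_eqI) (simp add: lookup_hcomp lookup_add)

lemma hcomp_0 [simp]: "hcomp k 0 = 0"
  by (rule poly_mapping_eqI) (simp add: lookup_hcomp)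

lemma hcomp_cscale: "hcomp k (cscale c F) = cscale c (hcomp k F)"
  by (rule poly_mapping_eqI) (simp add: lookup_hcomp)

lemma hcomp_sum: "hcomp k (\<Sum>i\<in>I. F i) = (\<Sum>i\<in>I. hcomp k (F i))"
  by (induction I rule: infinite_finite_induct) (auto simp: hcomp_add)

lemma hcomp_homogeneous: "homogeneous j F \<Longrightarrow> hcomp k F = (if j = k then F else 0)"
  by (rule poly_mapping_eqI) (auto simp: lookup_hcomp homogeneous_def in_keys_iff)

lemma homogeneous_hcomp: "homogeneous k (hcomp k F)"
  by (auto simp: homogeneous_def in_keys_iff lookup_hcomp split: if_splits)

text \<open>Multiplication by a form of degree \<open>l\<close> raises the degree of each term by
  exactly \<open>l\<close>.\<close>

lemma hcomp_mult_homogeneous: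
  assumes "homogeneous l G"
  shows "hcomp (k + l) (F * G) = hcomp k F * G"
proof -
  have "F * G = (\<Sum>\<alpha>\<in>keys F. Poly_Mapping.single \<alpha> (lookup F \<alpha>) * G)"
    using arg_cong[OF mpoly_expand[of F], of "\<lambda>F. F * G"] by (simp only: sum_distrib_right)
  moreover have "hcomp (k + l) (Poly_Mapping.single \<alpha> c * G)
      = (if mdeg \<alpha> = k then Poly_Mapping.single \<alpha> c * G else 0)" for \<alpha> c
  proof -
    have "homogeneous (mdeg \<alpha>) (Poly_Mapping.single \<alpha> c :: 'a mpoly)"
      by (simp add: homogeneous_def)
    from homogeneous_mult[OF this assms] show ?thesis
      by (subst hcomp_homogeneous) auto
  qed
  ultimately have "hcomp (k + l) (F * G)
      = (\<Sum>\<alpha>\<in>keys F. if mdeg \<alpha> = k then Poly_Mapping.single \<alpha> (lookup F \<alpha>) * G else 0)"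
    by (simp add: hcomp_sum)
  also have "\<dots> = hcomp k F * G"
    unfolding hcomp_def sum_distrib_right by (rule sum.inter_filter[symmetric]) simp
  finally show ?thesis .
qed

text \<open>Scalars become constant polynomials, so that ring algebra can expand products with
  scaled factors.\<close>

lemma cscale_conv_mult: "cscale c F = Poly_Mapping.single 0 c * (F :: 'v mpoly)"
proof -
  have "Poly_Mapping.single 0 c * F
      = (\<Sum>\<alpha>\<in>keys F. Poly_Mapping.single \<alpha> (c * lookup F \<alpha>))"
    using arg_cong[OF mpoly_expand[of F], of "\<lambda>F. Poly_Mapping.single 0 c * F"]
    by (simp add: sum_distrib_left mult_single)
  then show ?thesis
    by (intro poly_mapping_eqI) (auto simp: lookup_sum lookup_single when_def in_keys_iff)
qed

lemma cscale_mult_left: "cscale c F * G = cscale c (F * G :: 'v mpoly)"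
  by (simp add: cscale_conv_mult mult_ac)

lemma keys_cscale: "keys (cscale c v) \<subseteq> keys v"
  by (auto simp: in_keys_iff)

lemma forms_eq: "forms n k = {v. keys v \<subseteq> mons n k}"
  by (auto simp: forms_def mpolys_def homogeneous_def mons_def)

lemma subspace_keys: "pm.subspace {v. keys v \<subseteq> A}"
  unfolding pm.subspace_def mem_Collect_eq
proof (intro conjI ballI allI impI)
  show "keys (x + y) \<subseteq> A" if "x \<in> {v. keys v \<subseteq> A}" "y \<in> {v. keys v \<subseteq> A}" for x y :: "'a \<Rightarrow>\<^sub>0 complex"
    using that keys_add[of x y] by blast
  show "keys (cscale c x) \<subseteq> A" if "x \<in> {v. keys v \<subseteq> A}" for c and x :: "'a \<Rightarrow>\<^sub>0 complex"
    using that keys_cscale[of c x] by blast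
qed simp

lemma forms_span: "forms n k \<subseteq> pm.span ((\<lambda>\<alpha>. Poly_Mapping.single \<alpha> 1) ` mons n k)"
proof
  fix v assume "v \<in> forms n k"
  then have eq: "v = (\<Sum>\<alpha>\<in>mons n k. cscale (lookup v \<alpha>) (Poly_Mapping.single \<alpha> 1))"
    by (intro coordinate_expansion finite_mons) (simp add: forms_eq)
  show "v \<in> pm.span ((\<lambda>\<alpha>. Poly_Mapping.single \<alpha> 1) ` mons n k)"
    by (subst eq) (intro pm.span_sum pm.span_scale pm.span_base imageI)
qed

lemma units_subset_forms: "(\<lambda>\<alpha>. Poly_Mapping.single \<alpha> 1) ` mons n k \<subseteq> forms n k"
  by (auto simp: forms_eq)

lemma dim_forms: "pm.dim (forms n k) = card (mons n k)"
  by (rule pm.dim_unique[OF units_subset_forms forms_span independent_units card_units])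

section \<open>Chains of irreducible closed sets\<close>

text \<open>A criterion for irreducibility of the closure that can be checked by writing down
  curves.\<close>

definition poly_connected :: "('v \<Rightarrow>\<^sub>0 complex) set \<Rightarrow> bool" where
  "poly_connected Y \<longleftrightarrow> (\<forall>v\<in>Y. \<forall>w\<in>Y. \<exists>u p. u 0 = v \<and> u 1 = w \<and> range u \<subseteq> Y \<and>
    (\<forall>t \<alpha>. lookup (u t) \<alpha> = poly (p \<alpha>) t))"

lemma meval_poly_curve:
  assumes "\<And>t \<alpha>. lookup (u t) \<alpha> = poly (p \<alpha>) t"
  shows "\<exists>q. \<forall>t. meval F (lookup (u t)) = poly q t"
  by (rule exI[of _ "\<Sum>\<alpha>\<in>keys F. smult (lookup F \<alpha>) (\<Prod>i\<in>keys \<alpha>. p i ^ lookup \<alpha> i)"])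
    (simp add: meval_def mon_eval_def assms poly_sum poly_prod)

text \<open>On a polynomial curve joining \<open>v\<close> to \<open>w\<close>, both
  \<open>F\<close> and \<open>G\<close> become nonzero polynomials in one variable, with finitely
  many roots in total.\<close>

lemma poly_connected_prime:
  assumes Y: "poly_connected Y" and v: "v \<in> Y" "meval F (lookup v) \<noteq> 0"
    and w: "w \<in> Y" "meval G (lookup w) \<noteq> 0"
  shows "\<exists>y\<in>Y. meval F (lookup y) \<noteq> 0 \<and> meval G (lookup y) \<noteq> 0"
proof -
  obtain u p where u: "u 0 = v" "u 1 = w" "range u \<subseteq> Y" "\<And>t \<alpha>. lookup (u t) \<alpha> = poly (p \<alpha>) t"
    using Y v(1) w(1) unfolding poly_connected_def by metis
  obtain f where f: "\<And>t. meval F (lookup (u t)) = poly f t"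
    using meval_poly_curve[of u p F] u(4) by blast
  obtain g where g: "\<And>t. meval G (lookup (u t)) = poly g t"
    using meval_poly_curve[of u p G] u(4) by blast
  have "f \<noteq> 0" "g \<noteq> 0" using f[of 0] g[of 1] u v w by auto
  then have "finite ({t. poly f t = 0} \<union> {t. poly g t = 0})"
    by (simp add: poly_roots_finite)
  then obtain t :: complex where "t \<notin> {t. poly f t = 0} \<union> {t. poly g t = 0}"
    using ex_new_if_finite[OF infinite_UNIV_char_0] by blast
  then show ?thesis using f[of t] g[of t] u(3) by (intro bexI[of _ "u t"]) auto
qed

text \<open>If two closed sets each miss a point of \<open>Y\<close>, each lies in the zero set of a
  form not vanishing at the missed point, and \<open>poly_connected_prime\<close> finds one point of
  \<open>Y\<close> outside both.\<close>

lemma irreducible_closed_closure_of: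
  assumes Y: "Y \<noteq> {}" "\<And>v. v \<in> Y \<Longrightarrow> v \<noteq> 0 \<and> keys v \<subseteq> V" "poly_connected Y"
  shows "irreducible_closed (zariski_proj V) (zariski_proj V closure_of (proj_point ` Y))"
  unfolding irreducible_closed_def
proof (intro conjI allI impI)
  have sub: "proj_point ` Y \<subseteq> proj_space V" using Y(2) by (auto simp: proj_space_def)
  have cl: "proj_point ` Y \<subseteq> zariski_proj V closure_of (proj_point ` Y)"
    by (rule closure_of_subset) (simp add: sub)
  show "closedin (zariski_proj V) (zariski_proj V closure_of (proj_point ` Y))" by simp
  show "zariski_proj V closure_of (proj_point ` Y) \<noteq> {}" using cl Y(1) by blast
  fix A B assume A: "closedin (zariski_proj V) A" and B: "closedin (zariski_proj V) B"
    and AB: "zariski_proj V closure_of (proj_point ` Y) \<subseteq> A \<union> B"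
  have outside: "\<exists>F. \<exists>k. homogeneous k F \<and> (\<forall>x\<in>C. proj_van F x) \<and> meval F (lookup v) \<noteq> 0"
    if C: "closedin (zariski_proj V) C" and v: "v \<in> Y" "proj_point v \<notin> C" for C v
  proof -
    obtain E where E: "E \<subseteq> hom_mpolys V" "C = zero_locus (proj_space V) proj_van E"
      using C unfolding closedin_zariski_proj by blast
    then obtain F where F: "F \<in> E" "\<not> proj_van F (proj_point v)"
      using v sub unfolding zero_locus_def by blast
    then obtain k where "homogeneous k F" using E(1) by (auto simp: hom_mpolys_def)
    then show ?thesis using F E(2) proj_van_proj_point[of k F v] by (auto simp: zero_locus_def)
  qed
  have "proj_point ` Y \<subseteq> A \<or> proj_point ` Y \<subseteq> B"
  proof (rule ccontr)
    assume "\<not> ?thesis"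
    then obtain v w where v: "v \<in> Y" "proj_point v \<notin> A" and w: "w \<in> Y" "proj_point w \<notin> B" by blast
    obtain F k where F: "homogeneous k F" "\<forall>x\<in>A. proj_van F x" "meval F (lookup v) \<noteq> 0"
      using outside[OF A v] by blast
    obtain G l where G: "homogeneous l G" "\<forall>x\<in>B. proj_van G x" "meval G (lookup w) \<noteq> 0"
      using outside[OF B w] by blast
    obtain y where y: "y \<in> Y" "meval F (lookup y) \<noteq> 0" "meval G (lookup y) \<noteq> 0"
      using poly_connected_prime[OF Y(3) v(1) F(3) w(1) G(3)] by blast
    then have "proj_point y \<notin> A" "proj_point y \<notin> B"
      using F G proj_van_proj_point[OF F(1), of y] proj_van_proj_point[OF G(1), of y] by blast+
    then show False using y(1) cl AB by blast
  qed
  then show "zariski_proj V closure_of (proj_point ` Y) \<subseteq> A \<or>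
      zariski_proj V closure_of (proj_point ` Y) \<subseteq> B"
    using A B closure_of_minimal by blast
qed

lemma irreducible_closed_subtopology:
  assumes "closedin X T" "irreducible_closed X Z" "Z \<subseteq> T"
  shows "irreducible_closed (subtopology X T) Z"
  using assms unfolding irreducible_closed_def
  by (simp add: closedin_closed_subtopology)

lemma krull_dim_ge:
  assumes "\<And>i. i \<le> k \<Longrightarrow> irreducible_closed X (Z i)" "\<And>i. i < k \<Longrightarrow> Z i \<subset> Z (Suc i)"
  shows "enat k \<le> krull_dim X"
  unfolding krull_dim_def by (rule Sup_upper) (use assms in blast)

text \<open>The chain consists of the closures of the images of the \<open>Y i\<close>. A form
  vanishing on \<open>Y i\<close> also vanishes on the closure, so one point of
  \<open>Y (Suc i)\<close> where it is nonzero makes the inclusion strict.\<close>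

lemma krull_dim_chain:
  assumes T: "closedin (zariski_proj V) T"
    and Y: "\<And>i. i \<le> N \<Longrightarrow> Y i \<noteq> {} \<and> poly_connected (Y i)"
      "\<And>i v. i \<le> N \<Longrightarrow> v \<in> Y i \<Longrightarrow> v \<noteq> 0 \<and> keys v \<subseteq> V \<and> proj_point v \<in> T"
    and mono: "\<And>i. i < N \<Longrightarrow> Y i \<subseteq> Y (Suc i)"
    and sep: "\<And>i. i < N \<Longrightarrow> \<exists>F\<in>hom_mpolys V. (\<forall>v\<in>Y i. meval F (lookup v) = 0) \<and>
      (\<exists>v\<in>Y (Suc i). meval F (lookup v) \<noteq> 0)"
  shows "enat N \<le> krull_dim (subtopology (zariski_proj V) T)"
proof (rule krull_dim_ge)
  let ?Z = "\<lambda>i. zariski_proj V closure_of (proj_point ` Y i)"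
  fix i
  show "irreducible_closed (subtopology (zariski_proj V) T) (?Z i)" if i: "i \<le> N"
  proof (rule irreducible_closed_subtopology[OF T])
    show "irreducible_closed (zariski_proj V) (?Z i)"
      using Y[OF i] by (intro irreducible_closed_closure_of) auto
    show "?Z i \<subseteq> T" using Y(2)[OF i] T by (intro closure_of_minimal) auto
  qed
  show "?Z i \<subset> ?Z (Suc i)" if i: "i < N"
  proof
    show "?Z i \<subseteq> ?Z (Suc i)" using mono[OF i] by (intro closure_of_mono) auto
    obtain F v where F: "F \<in> hom_mpolys V" "\<forall>v\<in>Y i. meval F (lookup v) = 0"
      and v: "v \<in> Y (Suc i)" "meval F (lookup v) \<noteq> 0"
      using sep[OF i] by blast
    obtain k where k: "homogeneous k F" using F(1) by (auto simp: hom_mpolys_def)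
    have "proj_point ` Y i \<subseteq> zero_locus (proj_space V) proj_van {F}"
      using F(2) Y(2)[of i] i by (auto simp: zero_locus_def proj_van_proj_point[OF k] proj_space_def)
    moreover have "closedin (zariski_proj V) (zero_locus (proj_space V) proj_van {F})"
      using F(1) unfolding closedin_zariski_proj by blast
    ultimately have "?Z i \<subseteq> zero_locus (proj_space V) proj_van {F}" by (rule closure_of_minimal)
    moreover have "proj_point v \<notin> zero_locus (proj_space V) proj_van {F}"
      using v(2) by (simp add: zero_locus_def proj_van_proj_point[OF k])
    moreover have "proj_point ` Y (Suc i) \<subseteq> topspace (zariski_proj V)"
      using Y(2)[of "Suc i"] i by (auto simp: proj_space_def)
    then have "proj_point v \<in> ?Z (Suc i)" using closure_of_subset v(1) by blast
    ultimately show "?Z i \<noteq> ?Z (Suc i)" by blast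
  qed
qed

text \<open>In the chain, \<open>A\<close> consists of exponent vectors, so these are linear
  equations in the coefficients of a polynomial.\<close>

definition linear_form :: "'v set \<Rightarrow> ('v \<Rightarrow> complex) \<Rightarrow> 'v mpoly" where
  "linear_form A a = (\<Sum>\<alpha>\<in>A. Poly_Mapping.single (Poly_Mapping.single \<alpha> 1) (a \<alpha>))"

lemma meval_linear_form: "meval (linear_form A a) x = (\<Sum>\<alpha>\<in>A. a \<alpha> * x \<alpha>)"
  by (simp add: linear_form_def meval_sum meval_single mon_eval_def)

lemma linear_form_hom_mpolys: "A \<subseteq> V \<Longrightarrow> linear_form A a \<in> hom_mpolys V"
proof -
  assume A: "A \<subseteq> V"
  have "keys (linear_form A a) \<subseteq> (\<lambda>\<alpha>. Poly_Mapping.single \<alpha> 1) ` A"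
    unfolding linear_form_def using keys_sum by (fastforce split: if_splits)
  then show ?thesis using A
    by (fastforce simp: hom_mpolys_def mpolys_def homogeneous_def mdeg_def intro!: exI[of _ 1])
qed

section \<open>Chains in a Taylor variety\<close>

text \<open>The equation \<open>Q * S = P\<close> determines \<open>S\<close> recursively by degree,
  so a polynomial solving it up to degree \<open>m\<close> is the truncation of
  \<open>S\<close>.\<close>

lemma taylor_poly_eq:
  assumes Q: "meval Q (\<lambda>_. 0) = 1" and v: "keys v \<subseteq> exps n m"
    and eq: "\<And>\<alpha>. mdeg \<alpha> \<le> m \<Longrightarrow> lookup (Q * v) \<alpha> = lookup P \<alpha>"
  shows "taylor_poly n m P Q = v"
proof -
  have Q0: "lookup (Q - 1) 0 = 0"
    using Q by (simp add: meval_at_0 lookup_minus)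
  define S where "S = taylor_series P Q"
  have S: "prod_fun (lookup Q) S = lookup P"
    unfolding S_def taylor_series_def by (rule theI'[OF ex1_taylor_series[OF Q]])
  have "S \<gamma> = lookup v \<gamma>" if "mdeg \<gamma> \<le> m" for \<gamma>
    using that
  proof (induction "mdeg \<gamma>" arbitrary: \<gamma> rule: less_induct)
    case less
    \<comment> \<open>\<open>Q - 1\<close> has no constant term, so only coefficients of smaller
      degree enter.\<close>
    have "prod_fun (lookup (Q - 1)) S \<gamma> = prod_fun (lookup (Q - 1)) (lookup v) \<gamma>"
    proof (rule prod_fun_cong_mdeg)
      fix l q assume l: "lookup (Q - 1) l \<noteq> 0" "\<gamma> = l + q"
      then have "mdeg l \<noteq> 0" using Q0 by (auto simp: mdeg_eq_0_iff)
      then show "S q = lookup v q" using less l by (simp add: mdeg_add)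
    qed
    then show ?case
      using eq[OF less.prems] fun_cong[OF S, of \<gamma>]
      by (simp add: prod_fun_diff prod_fun_one prod_fun_lookup left_diff_distrib lookup_minus)
  qed
  then have "taylor_poly n m P Q = (\<Sum>\<alpha>\<in>exps n m. Poly_Mapping.single \<alpha> (lookup v \<alpha>))"
    unfolding taylor_poly_def S_def by (intro sum.cong) (auto simp: exps_def)
  also have "\<dots> = (\<Sum>\<alpha>\<in>keys v. Poly_Mapping.single \<alpha> (lookup v \<alpha>))"
    using v by (intro sum.mono_neutral_right finite_exps) (auto simp: in_keys_iff)
  also have "\<dots> = v" by (rule mpoly_expand[symmetric])
  finally show ?thesis .
qed

lemma lookup_mult_0: "lookup (F * G) 0 = lookup F 0 * lookup (G :: 'v mpoly) 0"
  using meval_mult[of F G "\<lambda>_. 0"] by (simp add: meval_at_0)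

lemma polys_le_mpolys: "polys_le n d \<subseteq> mpolys {..<n}"
  by (auto simp: polys_le_def mpolys_def exps_def)

lemma subspace_polys_le: "pm.subspace (polys_le n d)"
  unfolding polys_le_def by (rule subspace_keys)

lemma subspace_mpolys: "pm.subspace (mpolys V)"
  using subspace_keys[of "{\<alpha>. keys \<alpha> \<subseteq> V}"] by (simp add: mpolys_def subset_eq)

lemma zero_polys_le: "0 \<in> polys_le n d"
  by (simp add: polys_le_def)

lemma one_polys_le: "1 \<in> polys_le n d"
  by (auto simp: polys_le_def exps_def mdeg_def)

lemma hcomp_polys_le: "T \<in> polys_le n d \<Longrightarrow> hcomp (Suc d) T = 0"
  by (rule poly_mapping_eqI) (auto simp: lookup_hcomp polys_le_def exps_def in_keys_iff)

text \<open>For \<open>T(0) = 1\<close> and \<open>Q(0) = 0\<close> this is the Taylor polynomial of order \<open>d + 1\<close> of the quotient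
  whose denominator is \<open>1 - Q\<close> and whose Taylor polynomial of order \<open>d\<close> is \<open>T\<close>.\<close>

definition taylor_point :: "nat \<Rightarrow> 'v mpoly \<Rightarrow> 'v mpoly \<Rightarrow> 'v mpoly" where
  "taylor_point d T Q = T + hcomp (Suc d) (Q * T)"

lemma taylor_point_keys:
  assumes "T \<in> polys_le n d" "Q \<in> polys_le n e"
  shows "keys (taylor_point d T Q) \<subseteq> exps n (Suc d)"
proof -
  have "Q * T \<in> mpolys {..<n}" using assms polys_le_mpolys by (blast intro: mpolys_mult)
  then have "keys (hcomp (Suc d) (Q * T)) \<subseteq> exps n (Suc d)"
    by (auto simp: mpolys_def exps_def in_keys_iff lookup_hcomp split: if_splits)
  moreover have "keys T \<subseteq> exps n (Suc d)" using assms(1) by (auto simp: polys_le_def exps_def)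
  ultimately show ?thesis unfolding taylor_point_def
    using keys_add[of T "hcomp (Suc d) (Q * T)"] by blast
qed

lemma lookup_taylor_point_le:
  "mdeg \<alpha> \<le> d \<Longrightarrow> lookup (taylor_point d T Q) \<alpha> = lookup T \<alpha>"
  by (simp add: taylor_point_def lookup_add lookup_hcomp)

text \<open>The denominator is \<open>1 - Q\<close>, the numerator its product with the point, cut
  off above degree \<open>d\<close>. This works because the tail in \<open>taylor_point\<close>
  cancels the part of degree \<open>d + 1\<close> of that product.\<close>

lemma taylor_point_in_variety:
  assumes T: "T \<in> polys_le n d" "lookup T 0 = 1" and Q: "Q \<in> polys_le n e" "lookup Q 0 = 0"
  shows "proj_point (taylor_point d T Q) \<in> taylor_variety n d e (Suc d)"
proof -
  let ?v = "taylor_point d T Q"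
  define H where "H = hcomp (Suc d) (Q * T)"
  define P where "P = (\<Sum>k\<le>d. hcomp k ((1 - Q) * ?v))"
  have keys_v: "keys ?v \<subseteq> exps n (Suc d)" using T(1) Q(1) by (rule taylor_point_keys)
  have v0: "lookup ?v 0 = 1" using T(2) by (simp add: lookup_taylor_point_le mdeg_def)
  have R: "1 - Q \<in> polys_le n e"
    using subspace_polys_le one_polys_le Q(1) by (rule pm.subspace_diff)
  have R0: "lookup (1 - Q) 0 = 1" using Q(2) by (simp add: lookup_minus)
  have P: "lookup P \<alpha> = (if mdeg \<alpha> \<le> d then lookup ((1 - Q) * ?v) \<alpha> else 0)" for \<alpha>
    by (simp add: P_def lookup_sum lookup_hcomp)
  have "?v \<in> polys_le n (Suc d)" using keys_v by (simp add: polys_le_def)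
  then have "(1 - Q) * ?v \<in> mpolys {..<n}"
    using R polys_le_mpolys by (blast intro: mpolys_mult)
  then have P_le: "P \<in> polys_le n d"
    by (auto simp: polys_le_def exps_def mpolys_def in_keys_iff P split: if_splits)
  \<comment> \<open>Since \<open>Q\<close> has no constant term, \<open>Q * H\<close> contributes
    nothing in degree \<open>d + 1\<close>.\<close>
  have "hcomp 0 Q = 0"
    by (rule poly_mapping_eqI) (simp add: lookup_hcomp mdeg_eq_0_iff Q(2))
  then have "hcomp (Suc d) (Q * H) = 0"
    using hcomp_mult_homogeneous[of "Suc d" H 0 Q] by (simp add: H_def homogeneous_hcomp)
  moreover have "(1 - Q) * ?v = T + H - Q * T - Q * H"
    by (simp add: taylor_point_def H_def algebra_simps)
  moreover have "hcomp (Suc d) (T + H - Q * T - Q * H)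
      = hcomp (Suc d) T + hcomp (Suc d) H - hcomp (Suc d) (Q * T) - hcomp (Suc d) (Q * H)"
    by (rule poly_mapping_eqI) (simp add: lookup_hcomp lookup_add lookup_minus)
  moreover have "hcomp (Suc d) H = H"
    using homogeneous_hcomp hcomp_homogeneous unfolding H_def by metis
  ultimately have top: "hcomp (Suc d) ((1 - Q) * ?v) = 0"
    using hcomp_polys_le[OF T(1)] by (simp add: H_def)
  have "taylor_poly n (Suc d) P (1 - Q) = ?v"
  proof (rule taylor_poly_eq)
    show "meval (1 - Q) (\<lambda>_. 0) = 1" using R0 by (simp add: meval_at_0)
    show "keys ?v \<subseteq> exps n (Suc d)" by (rule keys_v)
    fix \<alpha> :: "nat \<Rightarrow>\<^sub>0 nat" assume \<alpha>: "mdeg \<alpha> \<le> Suc d"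
    show "lookup ((1 - Q) * ?v) \<alpha> = lookup P \<alpha>"
    proof (cases "mdeg \<alpha> = Suc d")
      case True
      then show ?thesis
        using arg_cong[OF top, of "\<lambda>F. lookup F \<alpha>"] by (simp add: P lookup_hcomp)
    qed (use \<alpha> in \<open>simp add: P\<close>)
  qed
  moreover have "meval P (\<lambda>_. 0) = 1"
    using R0 v0 by (simp add: meval_at_0 P mdeg_def lookup_mult_0)
  ultimately have mem: "proj_point ?v \<in> {proj_point (taylor_poly n (Suc d) P Q) | P Q.
      P \<in> polys_le n d \<and> Q \<in> polys_le n e \<and> meval P (\<lambda>_. 0) = 1 \<and> meval Q (\<lambda>_. 0) = 1}"
    using P_le R R0 by (intro CollectI exI[of _ P] exI[of _ "1 - Q"]) (simp add: meval_at_0)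
  have "?v \<noteq> 0" using v0 by auto
  then have "proj_point ?v \<in> topspace (zariski_proj (exps n (Suc d)))"
    unfolding topspace_zariski_proj proj_space_def using keys_v by blast
  from IntI[OF this mem] show ?thesis
    unfolding taylor_variety_def by (rule subsetD[OF closure_of_subset_Int])
qed

text \<open>For fixed \<open>T\<close> the points \<open>taylor_point d T Q\<close> depend affinely
  on \<open>Q\<close> and form a translate of this linear space, whose dimension is the rank of the
  fibre over \<open>T\<close>.\<close>

definition tails :: "nat \<Rightarrow> nat \<Rightarrow> nat \<Rightarrow> nat mpoly \<Rightarrow> nat mpoly set" where
  "tails n d e T = {hcomp (Suc d) (Q * T) | Q. Q \<in> polys_le n e \<and> lookup Q 0 = 0}"

lemma subspace_tails: "pm.subspace (tails n d e T)"
  unfolding pm.subspace_def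
proof (intro conjI ballI allI)
  show "0 \<in> tails n d e T"
    unfolding tails_def by (intro CollectI exI[of _ 0]) (simp add: zero_polys_le)
next
  fix x y assume "x \<in> tails n d e T" "y \<in> tails n d e T"
  then obtain P Q where "x = hcomp (Suc d) (P * T)" "P \<in> polys_le n e" "lookup P 0 = 0"
    "y = hcomp (Suc d) (Q * T)" "Q \<in> polys_le n e" "lookup Q 0 = 0"
    unfolding tails_def by blast
  then have "x + y = hcomp (Suc d) ((P + Q) * T)" "P + Q \<in> polys_le n e" "lookup (P + Q) 0 = 0"
    by (simp_all add: hcomp_add distrib_right lookup_add pm.subspace_add[OF subspace_polys_le])
  then show "x + y \<in> tails n d e T" unfolding tails_def by blast
next
  fix c x assume "x \<in> tails n d e T"
  then obtain Q where "x = hcomp (Suc d) (Q * T)" "Q \<in> polys_le n e" "lookup Q 0 = 0"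
    unfolding tails_def by blast
  then have "cscale c x = hcomp (Suc d) (cscale c Q * T)" "cscale c Q \<in> polys_le n e"
    "lookup (cscale c Q) 0 = 0"
    by (simp_all add: hcomp_cscale cscale_mult_left pm.subspace_scale[OF subspace_polys_le])
  then show "cscale c x \<in> tails n d e T" unfolding tails_def by blast
qed

lemma tails_forms:
  assumes "T \<in> polys_le n d"
  shows "tails n d e T \<subseteq> forms n (Suc d)"
proof
  fix x assume "x \<in> tails n d e T"
  then obtain Q where Q: "x = hcomp (Suc d) (Q * T)" "Q \<in> polys_le n e" unfolding tails_def by blast
  then have "Q * T \<in> mpolys {..<n}" using assms polys_le_mpolys by (blast intro: mpolys_mult)
  then show "x \<in> forms n (Suc d)"
    by (auto simp: Q forms_def homogeneous_hcomp mpolys_def in_keys_iff lookup_hcomp split: if_splits)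
qed

lemma tails_mono: "e \<le> e' \<Longrightarrow> tails n d e T \<subseteq> tails n d e' T"
  by (force simp: tails_def polys_le_def exps_def)

section \<open>Polynomial curves through Taylor points\<close>

lemma poly_connected_affine_subspace:
  assumes G: "pm.subspace G"
  shows "poly_connected {\<tau> + g | g. g \<in> G}"
  unfolding poly_connected_def
proof (intro ballI)
  fix v w assume "v \<in> {\<tau> + g | g. g \<in> G}" "w \<in> {\<tau> + g | g. g \<in> G}"
  then obtain g h where gh: "v = \<tau> + g" "w = \<tau> + h" "g \<in> G" "h \<in> G" by blast
  define u where "u t = \<tau> + (g + cscale t (h - g))" for t
  have "g + cscale t (h - g) \<in> G" for t
    using gh G by (intro pm.subspace_add pm.subspace_scale pm.subspace_diff)
  then have "range u \<subseteq> {\<tau> + g | g. g \<in> G}" unfolding u_def by blast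
  moreover have "u 0 = v" "u 1 = w" by (simp_all add: u_def gh)
  moreover have "lookup (u t) \<alpha> = poly [:lookup v \<alpha>, lookup (h - g) \<alpha>:] t" for t \<alpha>
    by (simp add: u_def gh lookup_add)
  ultimately show "\<exists>u p. u 0 = v \<and> u 1 = w \<and> range u \<subseteq> {\<tau> + g | g. g \<in> G} \<and>
      (\<forall>t \<alpha>. lookup (u t) \<alpha> = poly (p \<alpha>) t)"
    by (intro exI[of _ u] exI[of _ "\<lambda>\<alpha>. [:lookup v \<alpha>, lookup (h - g) \<alpha>:]"]) blast
qed

text \<open>Moving \<open>T\<close> and \<open>Q\<close> along straight lines at the same time gives
  a curve of degree at most two, because the tail is bilinear in \<open>Q\<close> and
  \<open>T\<close>.\<close>

lemma poly_connected_taylor_points: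
  assumes A: "\<And>x y t. x \<in> A \<Longrightarrow> y \<in> A \<Longrightarrow> x + cscale t (y - x) \<in> A"
    and B: "\<And>x y t. x \<in> B \<Longrightarrow> y \<in> B \<Longrightarrow> x + cscale t (y - x) \<in> B"
  shows "poly_connected {taylor_point d T Q | T Q. T \<in> A \<and> Q \<in> B}" (is "poly_connected ?Y")
  unfolding poly_connected_def
proof (intro ballI)
  fix v w assume "v \<in> ?Y" "w \<in> ?Y"
  then obtain T Q T' Q' where v: "v = taylor_point d T Q" "T \<in> A" "Q \<in> B"
    and w: "w = taylor_point d T' Q'" "T' \<in> A" "Q' \<in> B" by blast
  define D E where "D = Q' - Q" and "E = T' - T"
  define u where "u t = taylor_point d (T + cscale t E) (Q + cscale t D)" for t
  define p where "p \<alpha> = [:lookup v \<alpha>, lookup (E + hcomp (Suc d) (Q * E + D * T)) \<alpha>,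
      lookup (hcomp (Suc d) (D * E)) \<alpha>:]" for \<alpha>
  have "range u \<subseteq> ?Y" unfolding u_def D_def E_def using A B v w by blast
  moreover have "u 0 = v" "u 1 = w" by (simp_all add: u_def v w D_def E_def)
  moreover have "lookup (u t) \<alpha> = poly (p \<alpha>) t" for t \<alpha>
  proof -
    have "(Q + cscale t D) * (T + cscale t E)
        = Q * T + cscale t (Q * E + D * T) + cscale t (cscale t (D * E))"
      by (simp add: cscale_conv_mult algebra_simps)
    then have "u t = T + cscale t E + (hcomp (Suc d) (Q * T)
        + cscale t (hcomp (Suc d) (Q * E + D * T)) + cscale t (cscale t (hcomp (Suc d) (D * E))))"
      by (simp only: u_def taylor_point_def hcomp_add hcomp_cscale)
    then have "lookup (u t) \<alpha> = lookup T \<alpha> + t * lookup E \<alpha> + (lookup (hcomp (Suc d) (Q * T)) \<alpha>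
        + t * lookup (hcomp (Suc d) (Q * E + D * T)) \<alpha> + t * (t * lookup (hcomp (Suc d) (D * E)) \<alpha>))"
      by (simp only: lookup_add lookup_cscale)
    then show ?thesis
      unfolding p_def v(1) taylor_point_def lookup_add by (simp add: distrib_left)
  qed
  ultimately show "\<exists>u p. u 0 = v \<and> u 1 = w \<and> range u \<subseteq> ?Y \<and>
      (\<forall>t \<alpha>. lookup (u t) \<alpha> = poly (p \<alpha>) t)" by blast
qed

lemma linear_functional_coordinates:
  fixes l :: "('k \<Rightarrow>\<^sub>0 complex) \<Rightarrow> complex"
  assumes "Vector_Spaces.linear cscale (*) l" "finite A" "keys v \<subseteq> A"
  shows "l v = (\<Sum>\<alpha>\<in>A. l (Poly_Mapping.single \<alpha> 1) * lookup v \<alpha>)"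
proof -
  interpret l: Vector_Spaces.linear cscale "(*)" l by fact
  show ?thesis
    by (subst coordinate_expansion[OF assms(2,3)]) (simp add: l.sum l.scale mult.commute del: lookup_cscale)
qed

text \<open>The chain starts with linear subspaces of the fibre over \<open>\<tau>\<close> of the truncation to degree \<open>d\<close>, then
  lets the truncation vary over a flag of affine subspaces through \<open>\<tau>\<close>. So only the rank of the
  fibre over a single point matters.\<close>

lemma krull_dim_taylor_variety_ge:
  assumes \<tau>: "\<tau> \<in> polys_le n d" "lookup \<tau> 0 = 1"
    and F: "F \<subseteq> tails n d e \<tau>" "pm.independent F" "finite F"
  shows "enat (card (exps n d) - 1 + card F)
    \<le> krull_dim (subtopology (zariski_proj (exps n (Suc d))) (taylor_variety n d e (Suc d)))"
proof -
  define r where "r = card F"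
  define M where "M = card (exps n d) - 1"
  obtain f where f: "bij_betw f {0..<r} F"
    using ex_bij_betw_nat_finite[OF F(3)] unfolding r_def by blast
  have "0 \<in> exps n d" by (simp add: exps_def mdeg_def)
  then have "card (exps n d - {0}) = M" by (simp add: M_def finite_exps)
  then obtain a where a: "bij_betw a {0..<M} (exps n d - {0})"
    using ex_bij_betw_nat_finite[of "exps n d - {0}"] by (auto simp: finite_exps)
  \<comment> \<open>The flag of truncations: the first \<open>k\<close> nonconstant coefficients are
    free, the others are frozen at those of \<open>\<tau>\<close>.\<close>
  define A where "A k = {T. keys (T - \<tau>) \<subseteq> a ` {0..<k}}" for k
  define B where "B = {Q \<in> polys_le n e. lookup Q 0 = 0}"
  define G where "G j = pm.span (f ` {0..<j})" for j
  \<comment> \<open>For \<open>j > r\<close> all of \<open>B\<close> is allowed, so the tails may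
    leave the span of \<open>F\<close>; from there on strictness comes from the truncation
    alone.\<close>
  define Y where "Y j = (if j \<le> r then {\<tau> + g | g. g \<in> G j}
    else {taylor_point d T Q | T Q. T \<in> A (j - r) \<and> Q \<in> B})" for j
  have Ain: "T \<in> polys_le n d \<and> lookup T 0 = 1" if T: "T \<in> A k" and k: "k \<le> M" for T k
  proof -
    have "a ` {0..<k} \<subseteq> exps n d - {0}" using a k by (auto simp: bij_betw_def)
    then have *: "keys (T - \<tau>) \<subseteq> exps n d - {0}" using T by (auto simp: A_def)
    then have "T - \<tau> \<in> polys_le n d" by (auto simp: polys_le_def)
    then have "(T - \<tau>) + \<tau> \<in> polys_le n d" using subspace_polys_le \<tau>(1) by (intro pm.subspace_add)
    moreover have "0 \<notin> keys (T - \<tau>)" using * by blast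
    then have "lookup T 0 = 1" using \<tau>(2) by (simp add: in_keys_iff lookup_minus)
    ultimately show ?thesis by simp
  qed
  have Gtails: "G j \<subseteq> tails n d e \<tau>" if "j \<le> r" for j
  proof -
    have "f ` {0..<j} \<subseteq> F" using f that by (auto simp: bij_betw_def)
    then show ?thesis unfolding G_def using F(1) subspace_tails by (intro pm.span_minimal) auto
  qed
  have tail_point: "\<exists>Q\<in>B. \<tau> + g = taylor_point d \<tau> Q" if "g \<in> tails n d e \<tau>" for g
    using that unfolding tails_def B_def taylor_point_def by blast
  have \<tau>A: "\<tau> \<in> A k" for k by (simp add: A_def)
  have Ypoint: "\<exists>T Q. v = taylor_point d T Q \<and> T \<in> A (j - r) \<and> Q \<in> B" if v: "v \<in> Y j" for v j
  proof (cases "j \<le> r")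
    case True
    then obtain g where "v = \<tau> + g" "g \<in> G j" using v by (auto simp: Y_def)
    then show ?thesis using tail_point[of g] Gtails[OF True] \<tau>A by blast
  next
    case False
    then show ?thesis using v by (auto simp: Y_def)
  qed
  have lookY: "lookup v \<alpha> = lookup \<tau> \<alpha>"
    if v: "v \<in> Y j" and \<alpha>: "mdeg \<alpha> \<le> d" "\<alpha> \<notin> a ` {0..<j - r}" for v j \<alpha>
  proof -
    obtain T Q where T: "v = taylor_point d T Q" "T \<in> A (j - r)" using Ypoint[OF v] by blast
    then have "\<alpha> \<notin> keys (T - \<tau>)" using \<alpha>(2) by (auto simp: A_def)
    then show ?thesis using T(1) \<alpha>(1) by (simp add: lookup_taylor_point_le in_keys_iff lookup_minus)
  qed
  have zero_a: "0 \<notin> a ` {0..<k}" if "k \<le> M" for k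
    using a that by (auto simp: bij_betw_def)
  have "enat (M + r) \<le> krull_dim (subtopology (zariski_proj (exps n (Suc d))) (taylor_variety n d e (Suc d)))"
  proof (rule krull_dim_chain[where Y = Y])
    show "closedin (zariski_proj (exps n (Suc d))) (taylor_variety n d e (Suc d))"
      unfolding taylor_variety_def by simp
  next
    fix j assume "j \<le> M + r"
    show "Y j \<noteq> {} \<and> poly_connected (Y j)"
    proof (cases "j \<le> r")
      case True
      have "poly_connected {\<tau> + g | g. g \<in> G j}"
        unfolding G_def by (rule poly_connected_affine_subspace) simp
      moreover have "0 \<in> G j" unfolding G_def by (rule pm.span_zero)
      ultimately show ?thesis using True by (auto simp: Y_def)
    next
      case False
      have "poly_connected {taylor_point d T Q | T Q. T \<in> A (j - r) \<and> Q \<in> B}"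
      proof (rule poly_connected_taylor_points)
        fix x y t assume "x \<in> A (j - r)" "y \<in> A (j - r)"
        then have xy: "x - \<tau> \<in> {v. keys v \<subseteq> a ` {0..<j - r}}" "y - \<tau> \<in> {v. keys v \<subseteq> a ` {0..<j - r}}"
          by (simp_all add: A_def)
        have "x - \<tau> + cscale t (y - \<tau> - (x - \<tau>)) \<in> {v. keys v \<subseteq> a ` {0..<j - r}}"
          by (rule pm.subspace_add[OF subspace_keys xy(1) pm.subspace_scale[OF subspace_keys
              pm.subspace_diff[OF subspace_keys xy(2,1)]]])
        then show "x + cscale t (y - x) \<in> A (j - r)" by (simp add: A_def algebra_simps)
      next
        fix x y t assume "x \<in> B" "y \<in> B"
        then show "x + cscale t (y - x) \<in> B"
          by (simp add: B_def lookup_add lookup_minus pm.subspace_add[OF subspace_polys_le]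
              pm.subspace_scale[OF subspace_polys_le] pm.subspace_diff[OF subspace_polys_le])
      qed
      moreover have "0 \<in> B" by (simp add: B_def zero_polys_le)
      ultimately show ?thesis using False \<tau>A by (auto simp: Y_def)
    qed
  next
    fix j v assume j: "j \<le> M + r" and v: "v \<in> Y j"
    obtain T Q where T: "v = taylor_point d T Q" "T \<in> A (j - r)" and Q: "Q \<in> B"
      using Ypoint[OF v] by blast
    have T': "T \<in> polys_le n d" "lookup T 0 = 1" using Ain[OF T(2)] j by auto
    have Q': "Q \<in> polys_le n e" "lookup Q 0 = 0" using Q by (auto simp: B_def)
    have "lookup v 0 = 1" using T' T(1) by (simp add: lookup_taylor_point_le mdeg_def)
    then have "v \<noteq> 0" by auto
    then show "v \<noteq> 0 \<and> keys v \<subseteq> exps n (Suc d) \<and> proj_point v \<in> taylor_variety n d e (Suc d)"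
      using taylor_point_in_variety[OF T' Q'] taylor_point_keys[OF T'(1) Q'(1)] T(1) by blast
  next
    fix j assume "j < M + r"
    show "Y j \<subseteq> Y (Suc j)"
    proof
      fix v assume v: "v \<in> Y j"
      show "v \<in> Y (Suc j)"
      proof (cases "Suc j \<le> r")
        case True
        have "G j \<subseteq> G (Suc j)" unfolding G_def by (intro pm.span_mono) auto
        then show ?thesis using v True by (auto simp: Y_def)
      next
        case False
        \<comment> \<open>This also covers the passage at \<open>j = r\<close>, where
          \<open>Ypoint\<close> rewrites \<open>\<tau> + g\<close> as a Taylor point over
          \<open>\<tau>\<close>.\<close>
        have "A (j - r) \<subseteq> A (Suc j - r)" by (force simp: A_def)
        then show ?thesis using Ypoint[OF v] False by (auto simp: Y_def)
      qed
    qed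
  next
    fix j assume j: "j < M + r"
    show "\<exists>K\<in>hom_mpolys (exps n (Suc d)). (\<forall>v\<in>Y j. meval K (lookup v) = 0) \<and>
      (\<exists>v\<in>Y (Suc j). meval K (lookup v) \<noteq> 0)"
    proof (cases "j < r")
      case True
      have fj: "f i \<noteq> f j" if "i < j" for i
      proof
        assume "f i = f j"
        moreover have "i \<in> {0..<r}" "j \<in> {0..<r}" using that True by auto
        ultimately have "i = j" using f unfolding bij_betw_def inj_on_def by blast
        with that show False by simp
      qed
      \<comment> \<open>A functional dual to \<open>f j\<close> kills the span of the earlier
        \<open>f i\<close>. \<open>K\<close> expresses it in the coefficients of degree
        \<open>d + 1\<close>, where \<open>\<tau>\<close> is zero.\<close>
      obtain l where l: "Vector_Spaces.linear cscale (*) l"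
        and lF: "\<And>x. x \<in> F \<Longrightarrow> l x = (if x = f j then 1 else 0 :: complex)"
        using pmc.linear_independent_extend[OF F(2), of "\<lambda>x. if x = f j then 1 else 0"] by blast
      interpret l: Vector_Spaces.linear cscale "(*)" l by fact
      define K where "K = linear_form (mons n (Suc d)) (\<lambda>\<alpha>. l (Poly_Mapping.single \<alpha> 1))"
      have K: "meval K (lookup (\<tau> + g)) = l g" if g: "g \<in> tails n d e \<tau>" for g
      proof -
        have \<tau>0: "lookup \<tau> \<alpha> = 0" if "\<alpha> \<in> mons n (Suc d)" for \<alpha>
          using \<tau>(1) that by (auto simp: mons_def polys_le_def exps_def in_keys_iff)
        have "keys g \<subseteq> mons n (Suc d)" using g tails_forms[OF \<tau>(1)] by (auto simp: forms_eq)
        from linear_functional_coordinates[OF l finite_mons this] show ?thesis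
          unfolding K_def meval_linear_form by (simp add: lookup_add \<tau>0)
      qed
      show ?thesis
      proof (intro bexI conjI ballI)
        show "K \<in> hom_mpolys (exps n (Suc d))"
          unfolding K_def by (rule linear_form_hom_mpolys) (auto simp: mons_def exps_def)
        fix v assume "v \<in> Y j"
        then obtain g where g: "v = \<tau> + g" "g \<in> G j" using True by (auto simp: Y_def)
        have "l g = 0"
          using g(2) unfolding G_def
        proof (rule l.eq_0_on_span[rotated])
          fix x assume "x \<in> f ` {0..<j}"
          then obtain i where i: "x = f i" "i < j" by auto
          then have "x \<in> F" using f True by (auto simp: bij_betw_def)
          then show "l x = 0" using lF fj i by simp
        qed
        then show "meval K (lookup v) = 0" using K g Gtails[of j] True by auto
      next
        have "f j \<in> G (Suc j)" unfolding G_def by (rule pm.span_base) simp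
        then show "\<tau> + f j \<in> Y (Suc j)" using True by (auto simp: Y_def)
        have "f j \<in> F" using f True by (auto simp: bij_betw_def)
        then show "meval K (lookup (\<tau> + f j)) \<noteq> 0" using K lF F(1) by auto
      qed
    next
      case False
      define k where "k = j - r"
      have k: "k < M" "Suc j - r = Suc k" using False j by (auto simp: k_def)
      have ak: "a k \<in> exps n d" "a k \<noteq> 0" using a k by (auto simp: bij_betw_def)
      have aki: "a k \<notin> a ` {0..<k}"
      proof
        assume "a k \<in> a ` {0..<k}"
        then obtain i where i: "a k = a i" "i < k" by auto
        moreover have "i \<in> {0..<M}" "k \<in> {0..<M}" using i k by auto
        ultimately have "k = i" using a unfolding bij_betw_def inj_on_def by blast
        with i show False by simp
      qed
      \<comment> \<open>The equation freezing the coefficient at \<open>a k\<close>, made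
        homogeneous by the constant coefficient, which is \<open>1\<close> on all points of the
        chain.\<close>
      define K where "K = linear_form {a k, 0} (\<lambda>\<alpha>. if \<alpha> = 0 then - lookup \<tau> (a k) else 1)"
      have K: "meval K x = x (a k) - lookup \<tau> (a k) * x 0" for x
        unfolding K_def meval_linear_form using ak by simp
      show ?thesis
      proof (intro bexI conjI ballI)
        show "K \<in> hom_mpolys (exps n (Suc d))"
          unfolding K_def by (rule linear_form_hom_mpolys) (use ak in \<open>auto simp: exps_def mdeg_def\<close>)
        fix v assume v: "v \<in> Y j"
        have "lookup v (a k) = lookup \<tau> (a k)" "lookup v 0 = lookup \<tau> 0"
          using lookY[OF v] ak aki zero_a[of k] k unfolding k_def by (auto simp: exps_def mdeg_def)
        then show "meval K (lookup v) = 0" by (simp add: K \<tau>(2))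
      next
        let ?T = "\<tau> + Poly_Mapping.single (a k) 1"
        have "?T \<in> A (Suc k)" by (simp add: A_def)
        moreover have "0 \<in> B" by (simp add: B_def zero_polys_le)
        ultimately show "taylor_point d ?T 0 \<in> Y (Suc j)" using k False by (auto simp: Y_def)
        show "meval K (lookup (taylor_point d ?T 0)) \<noteq> 0"
          using ak by (simp add: K taylor_point_def lookup_add lookup_single when_def \<tau>(2))
      qed
    qed
  qed
  then show ?thesis by (simp add: M_def r_def)
qed

section \<open>The rank of a fibre under Froeberg's conjecture\<close>

lemma subspace_ideal_gen: "pm.subspace (ideal_gen n I g)"
  unfolding pm.subspace_def
proof (intro conjI ballI allI)
  show "0 \<in> ideal_gen n I g"
    unfolding ideal_gen_def by (intro CollectI exI[of _ "\<lambda>_. 0"]) (simp add: mpolys_def)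
next
  fix x y assume "x \<in> ideal_gen n I g" "y \<in> ideal_gen n I g"
  then obtain h k where "x = (\<Sum>i\<in>I. h i * g i)" "\<forall>i\<in>I. h i \<in> mpolys {..<n}"
    "y = (\<Sum>i\<in>I. k i * g i)" "\<forall>i\<in>I. k i \<in> mpolys {..<n}"
    unfolding ideal_gen_def by blast
  then have "x + y = (\<Sum>i\<in>I. (h i + k i) * g i)" "\<forall>i\<in>I. h i + k i \<in> mpolys {..<n}"
    by (simp_all add: distrib_right sum.distrib pm.subspace_add[OF subspace_mpolys])
  then show "x + y \<in> ideal_gen n I g"
    unfolding ideal_gen_def by (intro CollectI exI[of _ "\<lambda>i. h i + k i"] conjI)
next
  fix c x assume "x \<in> ideal_gen n I g"
  then obtain h where "x = (\<Sum>i\<in>I. h i * g i)" "\<forall>i\<in>I. h i \<in> mpolys {..<n}"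
    unfolding ideal_gen_def by blast
  then have "cscale c x = (\<Sum>i\<in>I. cscale c (h i) * g i)" "\<forall>i\<in>I. cscale c (h i) \<in> mpolys {..<n}"
    by (simp_all add: pm.scale_sum_right cscale_mult_left pm.subspace_scale[OF subspace_mpolys])
  then show "cscale c x \<in> ideal_gen n I g"
    unfolding ideal_gen_def by (intro CollectI exI[of _ "\<lambda>i. cscale c (h i)"] conjI)
qed

text \<open>The \<open>g i\<close> are the components of degrees \<open>d, \<dots>, d - e + 1\<close> of \<open>1 + (\<Sum>i=1..e. g i)\<close>, so the part of
  degree \<open>d + 1\<close> of a multiple of this polynomial is a combination of them.\<close>

lemma ideal_gen_subset_tails:
  assumes e: "e \<le> d" and g: "\<And>i. i \<in> {1..e} \<Longrightarrow> g i \<in> forms n (d + 1 - i)"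
  shows "ideal_gen n {1..e} g \<inter> forms n (d + 1) \<subseteq> tails n d e (1 + (\<Sum>i=1..e. g i))"
proof
  fix f assume f: "f \<in> ideal_gen n {1..e} g \<inter> forms n (d + 1)"
  then obtain h where h: "f = (\<Sum>i=1..e. h i * g i)" "\<And>i. i \<in> {1..e} \<Longrightarrow> h i \<in> mpolys {..<n}"
    unfolding ideal_gen_def by blast
  have hom: "homogeneous (d + 1 - i) (g i)" if "i \<in> {1..e}" for i
    using g[OF that] by (simp add: forms_def)
  \<comment> \<open>Only the component of degree \<open>i\<close> of \<open>h i\<close> contributes
    to \<open>h i * g i\<close> in degree \<open>d + 1\<close>.\<close>
  define Q where "Q = (\<Sum>i=1..e. hcomp i (h i))"
  have "hcomp i (h i) \<in> polys_le n e" if "i \<in> {1..e}" for i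
    using h(2)[OF that] that
    by (auto simp: polys_le_def exps_def mpolys_def in_keys_iff lookup_hcomp split: if_splits)
  then have Q_le: "Q \<in> polys_le n e"
    unfolding Q_def by (intro pm.subspace_sum subspace_polys_le)
  have Q0: "lookup Q 0 = 0"
    by (simp add: Q_def lookup_sum lookup_hcomp mdeg_def)
  \<comment> \<open>The constant term \<open>1\<close> contributes \<open>Q\<close> itself, whose
    degree is at most \<open>e \<le> d\<close>.\<close>
  have "hcomp (Suc d) Q = 0"
    unfolding Q_def hcomp_sum
    by (rule sum.neutral) (use e in \<open>auto simp: hcomp_homogeneous[OF homogeneous_hcomp]\<close>)
  then have "hcomp (Suc d) (Q * (1 + (\<Sum>i=1..e. g i)))
      = (\<Sum>i=1..e. \<Sum>j=1..e. hcomp (Suc d) (hcomp i (h i) * g j))"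
    by (simp add: distrib_left hcomp_add Q_def sum_product hcomp_sum)
  \<comment> \<open>The product has degree \<open>i + (d + 1 - j)\<close>, so only the diagonal
    survives.\<close>
  also have "\<dots> = (\<Sum>i=1..e. \<Sum>j=1..e. if i = j then hcomp i (h i) * g i else 0)"
  proof (intro sum.cong refl)
    fix i j assume ij: "i \<in> {1..e}" "j \<in> {1..e}"
    show "hcomp (Suc d) (hcomp i (h i) * g j) = (if i = j then hcomp i (h i) * g i else 0)"
      using hcomp_homogeneous[OF homogeneous_mult[OF homogeneous_hcomp hom[OF ij(2)]]] ij e by auto
  qed
  also have "\<dots> = (\<Sum>i=1..e. hcomp i (h i) * g i)" by simp
  also have "\<dots> = (\<Sum>i=1..e. hcomp (Suc d) (h i * g i))"
  proof (rule sum.cong[OF refl])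
    fix i assume i: "i \<in> {1..e}"
    then have "i + (d + 1 - i) = Suc d" using e by auto
    then show "hcomp i (h i) * g i = hcomp (Suc d) (h i * g i)"
      using hcomp_mult_homogeneous[OF hom[OF i], of i "h i"] by simp
  qed
  also have "\<dots> = hcomp (Suc d) f" by (simp add: h(1) hcomp_sum)
  also have "\<dots> = f" using f by (auto simp: forms_def hcomp_homogeneous)
  finally show "f \<in> tails n d e (1 + (\<Sum>i=1..e. g i))"
    unfolding tails_def using Q_le Q0 by fastforce
qed

text \<open>The positive part in Froeberg's conjecture is either the coefficient itself or zero, and in
  both cases the ideal has at least the expected dimension in degree \<open>d + 1\<close>.\<close>

lemma froeberg_tails:
  assumes fr: "froeberg_conjecture" and n: "1 \<le> n" and e: "1 \<le> e" "2 * e \<le> d + 1"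
  shows "\<exists>\<tau> F. \<tau> \<in> polys_le n d \<and> lookup \<tau> 0 = 1 \<and> F \<subseteq> tails n d e \<tau> \<and>
    pm.independent F \<and> finite F \<and> min (card (exps n e) - 1) (card (mons n (Suc d))) \<le> card F"
proof -
  have ed: "e \<le> d" using e by linarith
  define \<Phi> :: "real fps" where "\<Phi> = (\<Prod>i=1..e. 1 - fps_X ^ (d + 1 - i)) / (1 - fps_X) ^ n"
  let ?V = "forms n (d + 1)"
  obtain U where U: "openin (zariski_forms n {1..e} (\<lambda>i. d + 1 - i)) U" "U \<noteq> {}"
    and dimU: "\<forall>g\<in>U. real (quotient_dim ?V (ideal_gen n {1..e} g \<inter> ?V)) = fps_nth (fps_pos_part \<Phi>) (d + 1)"
    using fr[unfolded froeberg_conjecture_def, rule_format, OF n e(1) ed, folded \<Phi>_def] by blast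
  \<comment> \<open>One tuple of the open set suffices, since the chain uses the fibre over a single
    truncation.\<close>
  obtain g where g: "g \<in> U" using U(2) by blast
  then have gf: "g i \<in> forms n (d + 1 - i)" if "i \<in> {1..e}" for i
    using U(1) that unfolding openin_zariski_forms form_tuples_def by blast
  let ?W = "ideal_gen n {1..e} g \<inter> ?V"
  define q where "q = quotient_dim ?V ?W"
  have V: "pm.subspace ?V" unfolding forms_eq by (rule subspace_keys)
  obtain A where A: "A \<subseteq> ?W" "pm.independent A" "finite A" "card A + q = card (mons n (d + 1))"
    unfolding q_def dim_forms[symmetric]
    using quotient_dim_complement[OF pm.subspace_inter[OF subspace_ideal_gen V] _ forms_span _ V]
    by (metis finite_imageI finite_mons inf_le2)
  have "(0::nat \<Rightarrow>\<^sub>0 nat) \<in> exps n e" by (simp add: exps_def mdeg_def)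
  then have "card (exps n e) \<ge> 1" using finite_exps[of n e] by (simp add: Suc_le_eq card_gt_0_iff) blast
  moreover have "real q = (if \<forall>j\<le>d + 1. fps_nth \<Phi> j > 0 then fps_nth \<Phi> (d + 1) else 0)"
    using bspec[OF dimU g] unfolding q_def fps_pos_part_def fps_nth_Abs_fps .
  then have "q = 0 \<or> real q = real (card (mons n (d + 1))) - (real (card (exps n e)) - 1)"
    using froeberg_coefficient[OF n e(2)] unfolding \<Phi>_def by (auto split: if_splits)
  \<comment> \<open>If \<open>q = 0\<close>, then \<open>card A\<close> counts all monomials of
    degree \<open>d + 1\<close>; in the other case it is \<open>card (exps n e) - 1\<close>.\<close>
  ultimately have card: "min (card (exps n e) - 1) (card (mons n (Suc d))) \<le> card A"
    using A(4) by auto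
  define \<tau> where "\<tau> = 1 + (\<Sum>i=1..e. g i)"
  have gi: "g i \<in> polys_le n d \<and> lookup (g i) 0 = 0" if i: "i \<in> {1..e}" for i
  proof -
    have "keys (g i) \<subseteq> mons n (d + 1 - i)" using gf[OF i] by (simp add: forms_eq)
    moreover have "mons n (d + 1 - i) \<subseteq> exps n d - {0}"
      using i ed by (auto simp: mons_def exps_def mdeg_def)
    ultimately have "keys (g i) \<subseteq> exps n d" "0 \<notin> keys (g i)" by auto
    then show ?thesis by (simp add: polys_le_def in_keys_iff)
  qed
  then have "\<tau> \<in> polys_le n d"
    unfolding \<tau>_def by (intro pm.subspace_add pm.subspace_sum subspace_polys_le one_polys_le) blast
  moreover have "lookup \<tau> 0 = 1"
    unfolding \<tau>_def using gi by (simp add: lookup_add lookup_sum)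
  moreover have "A \<subseteq> tails n d e \<tau>"
    using A(1) ideal_gen_subset_tails[OF ed gf] unfolding \<tau>_def by blast
  ultimately show ?thesis using A(2,3) card by blast
qed

section \<open>From fibre ranks to defectiveness\<close>

lemma not_taylor_defective:
  assumes \<tau>: "\<tau> \<in> polys_le n d" "lookup \<tau> 0 = 1"
    and F: "F \<subseteq> tails n d e \<tau>" "pm.independent F" "finite F"
    and card: "min (card (exps n e) - 1) (card (mons n (Suc d))) \<le> card F"
  shows "\<not> taylor_defective n d e (d + 1)"
proof -
  have pos: "card (exps n k) \<ge> 1" for k by (simp add: card_exps Suc_le_eq)
  \<comment> \<open>Splitting \<open>exps n (Suc d)\<close> by degree shows both terms of the
    minimum as \<open>card (exps n d) - 1\<close> plus a term of the expected fibre rank.\<close>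
  have "min (((d + n) choose n) + ((e + n) choose n) - 2) (((d + 1 + n) choose n) - 1)
      = min (card (exps n d) + card (exps n e) - 2) (card (exps n d) + card (mons n (Suc d)) - 1)"
    using card_exps_Suc[of n d] by (simp add: card_exps)
  also have "\<dots> \<le> card (exps n d) - 1 + card F"
    using pos[of d] pos[of e] card by linarith
  finally show ?thesis
    using krull_dim_taylor_variety_ge[OF \<tau> F] unfolding taylor_defective_def not_less Suc_eq_plus1
    by (meson enat_ord_simps(1) order_trans)
qed

text \<open>For \<open>T = 1\<close> the tail is the component of degree \<open>d + 1\<close> of
  \<open>Q\<close>, and \<open>e > d\<close> admits any form of that degree as
  \<open>Q\<close>.\<close>

lemma forms_subset_tails_one: "d < e \<Longrightarrow> forms n (Suc d) \<subseteq> tails n d e 1"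
proof
  fix f assume e: "d < e" and f: "f \<in> forms n (Suc d)"
  have "hcomp (Suc d) (f * 1) = f"
    using f by (auto simp: forms_def hcomp_homogeneous[of "Suc d"])
  moreover have "f \<in> polys_le n e" "lookup f 0 = 0"
    using f e by (auto simp: forms_eq polys_le_def mons_def exps_def in_keys_iff mdeg_def subset_iff)
  ultimately show "f \<in> tails n d e 1" unfolding tails_def by force
qed

theorem theorem6p2:
  fixes n :: nat
  assumes "froeberg_conjecture" and "n \<ge> 3"
  shows "finite {(d :: nat, e :: nat). taylor_defective n d e (d + 1)}"
proof -
  \<comment> \<open>Twice the threshold of \<open>binomial_growth\<close>, so that half of any
    \<open>d \<ge> N\<close> still reaches it.\<close>
  define N where "N = 2 * (n ^ n * 3 ^ n)"
  have large_e: "\<not> taylor_defective n d e (d + 1)" if "d < e" for d e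
  proof (rule not_taylor_defective)
    let ?F = "(\<lambda>\<alpha>. Poly_Mapping.single \<alpha> (1 :: complex)) ` mons n (Suc d)"
    show "?F \<subseteq> tails n d e 1"
      using units_subset_forms forms_subset_tails_one[OF that] by blast
    show "min (card (exps n e) - 1) (card (mons n (Suc d))) \<le> card ?F" by (simp add: card_units)
  qed (auto simp: one_polys_le lookup_one independent_units finite_mons)
  have small_e: "\<not> taylor_defective n d e (d + 1)" if "2 * e \<le> d + 1" for d e
  \<comment> \<open>Froeberg's conjecture speaks of \<open>e \<ge> 1\<close>. For
    \<open>e = 0\<close> the expected fibre rank is \<open>0\<close>, and the empty set attains
    it.\<close>
  proof (cases "e = 0")
    case True
    then show ?thesis
      by (intro not_taylor_defective[of 1 _ _ "{}"])
        (auto simp: one_polys_le lookup_one card_exps pm.independent_empty)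
  next
    case False
    then have "1 \<le> e" by simp
    then show ?thesis
      using froeberg_tails[OF assms(1) _ _ that, of n] assms(2) not_taylor_defective by fastforce
  qed
  have large_d: "\<not> taylor_defective n d e (d + 1)" if d: "N \<le> d" for d e
  proof (cases "2 * e \<le> d + 1")
    case True
    then show ?thesis by (rule small_e)
  next
    case False
    \<comment> \<open>The largest value with \<open>2 * e' \<le> d + 1\<close>; its tails are
      contained in those for \<open>e\<close>.\<close>
    define e' where "e' = (d + 1) div 2"
    have e': "2 * e' \<le> d + 1" "e' \<le> e" "d \<le> 2 * e'" "n ^ n * 3 ^ n \<le> e'"
      using False d unfolding e'_def N_def by linarith+
    moreover have "1 \<le> n ^ n * 3 ^ n" using assms(2) by (simp add: Suc_le_eq)
    ultimately have "1 \<le> e'" by linarith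
    then obtain \<tau> F where F: "\<tau> \<in> polys_le n d" "lookup \<tau> 0 = 1" "F \<subseteq> tails n d e' \<tau>"
      "pm.independent F" "finite F" "min (card (exps n e') - 1) (card (mons n (Suc d))) \<le> card F"
      using froeberg_tails[OF assms(1) _ _ e'(1), of n] assms(2) by fastforce
    have "card (mons n (Suc d)) \<le> card (exps n e') - 1"
      using assms(2) e' by (intro binomial_growth) auto
    then have "card (mons n (Suc d)) \<le> card F" using F(6) by simp
    moreover have "F \<subseteq> tails n d e \<tau>" using F(3) tails_mono[OF e'(2)] by blast
    ultimately show ?thesis using F by (intro not_taylor_defective[of \<tau> _ _ F]) auto
  qed
  have "{(d, e). taylor_defective n d e (d + 1)} \<subseteq> {..<N} \<times> {..N}"
  proof
    fix x assume x: "x \<in> {(d, e). taylor_defective n d e (d + 1)}"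
    obtain d e where [simp]: "x = (d, e)" by (cases x)
    have "d < N" using x large_d[of d e] by (auto simp: not_less[symmetric])
    moreover have "e \<le> d" using x large_e[of d e] by (auto simp: not_less[symmetric])
    ultimately show "x \<in> {..<N} \<times> {..N}" by simp
  qed
  then show ?thesis by (rule finite_subset) simp
qed

end
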